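(* Let $n\in\mathbb{N}$ and let $\tau_{\psi},\tau_{\phi}\in\mathbb{R}_{+}$ with $\tau_{\psi}\geq \frac{1}{n}$. Put $\psi(q)=q^{-\tau_{\psi}}$ and $\phi(q)=q^{-\tau_{\phi}}$ for $q\in\mathbb{N}$, and let \[ W_{n}(\psi,\phi)=\left\{ \mathbf{x}\in[0,1]^{n} : (1-\phi(q))\frac{\psi(q)}{q}<\left\|\mathbf{x}-\frac{\mathbf{p}}{q}\right\|<\frac{\psi(q)}{q}\ \text{ for infinitely many } (\mathbf{p},q)\in\mathbb{Z}^{n}\times\mathbb{N}\right\}. \] Then \[ \dim_{H} W_{n}(\psi,\phi)=\min\left\{\frac{n+1}{1+\tau_{\psi}},\ \frac{n+1+(n-1)\tau_{\phi}}{1+\tau_{\psi}+\tau_{\phi}}\right\}. \]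
   Context: $\|\cdot\|$ denotes the maximum norm on $\mathbb{R}^{n}$, and $\dim_{H}$ denotes Hausdorff dimension. *)

theory Defs
  imports "HOL-Analysis.Analysis"
begin

text \<open>
  The contribution \<open>(diam U)\<^sup>s\<close> of one covering set, with the conventions that the empty set
  contributes \<open>0\<close> and that \<open>0\<^sup>0 = 1\<close> (whereas \<open>0 powr 0 = 0\<close>), so that \<open>s = 0\<close> gives
  counting measure.
\<close>

definition hausdorff_gauge :: "real \<Rightarrow> 'a::metric_space set \<Rightarrow> ennreal" where
  "hausdorff_gauge s U =
     (if U = {} then 0 else if s = 0 then 1 else ennreal (diameter U powr s))"

text \<open>
  Boundedness is required explicitly because \<open>diameter\<close> is an unspecified real number on
  unbounded sets. Finite covers are included, padded with empty sets.
\<close>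

definition hausdorff_covers :: "real \<Rightarrow> 'a::metric_space set \<Rightarrow> (nat \<Rightarrow> 'a set) set" where
  "hausdorff_covers \<delta> A =
     {U. A \<subseteq> (\<Union>i. U i) \<and> (\<forall>i. bounded (U i) \<and> diameter (U i) \<le> \<delta>)}"

definition hausdorff_premeasure :: "real \<Rightarrow> real \<Rightarrow> 'a::metric_space set \<Rightarrow> ennreal" where
  "hausdorff_premeasure \<delta> s A = (INF U\<in>hausdorff_covers \<delta> A. \<Sum>i. hausdorff_gauge s (U i))"

definition hausdorff_measure :: "real \<Rightarrow> 'a::metric_space set \<Rightarrow> ennreal" where
  "hausdorff_measure s A = (SUP \<delta>\<in>{0<..}. hausdorff_premeasure \<delta> s A)"

definition hausdorff_dim :: "'a::metric_space set \<Rightarrow> ereal" where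
  "hausdorff_dim A = Inf {ereal s | s. 0 \<le> s \<and> hausdorff_measure s A = 0}"

text \<open>
  The dimension \<open>n\<close> is \<open>CARD('n)\<close>, and \<open>infnorm\<close> is the maximum norm (see \<open>infnorm_cart\<close>).
\<close>

definition W :: "(nat \<Rightarrow> real) \<Rightarrow> (nat \<Rightarrow> real) \<Rightarrow> (real ^ 'n) set" where
  "W \<psi> \<phi> =
     {x. (\<forall>i. 0 \<le> x $ i \<and> x $ i \<le> 1) \<and>
         infinite {(p :: int ^ 'n, q :: nat). 1 \<le> q \<and>
            (1 - \<phi> q) * (\<psi> q / real q) < infnorm (x - (\<chi> i. real_of_int (p $ i) / real q)) \<and>
            infnorm (x - (\<chi> i. real_of_int (p $ i) / real q)) < \<psi> q / real q}}"

end

theory Submission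
  imports Defs
begin

text \<open>
  For the upper bound, cover the annuli with denominator \<open>q\<close>, either each by a single cube, or each by about
  \<open>q powr ((n - 1) * \<tau>\<phi>)\<close> cubes whose side is the thickness of the annulus, and sum over \<open>q\<close>.

  For the lower bound, Dirichlet's theorem provides in every cube of fixed side about \<open>N\<^sup>n\<^sup>+\<^sup>1\<close> rational points
  with denominators comparable to \<open>N\<close> that are separated by a constant times \<open>N powr (- 1 - 1/n)\<close>. As
  \<open>\<tau>\<psi> \<ge> 1/n\<close>, this is at least comparable to the radius of the annuli. Distributing mass uniformly over one face
  slab of each annulus gives a measure with \<open>\<mu> (cube x d) \<le> C * d powr s\<^sub>0\<close>, where \<open>s\<^sub>0\<close> is the claimed dimension.
  For \<open>s < s\<^sub>0\<close> this redistribution can be iterated on finer and finer scales with almost no loss in the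
  constant of the growth bound with exponent \<open>s\<close>. The supports are nested up to small neighbourhoods
  and the mass distribution principle applies to their limit, which lies in infinitely many annuli.
\<close>

section \<open>Hausdorff premeasures\<close>

text \<open>The two terms of the minimum match the two covers. There are about \<open>q ^ n\<close>
  annuli with denominator \<open>q\<close>, and the sums over \<open>q\<close> of
  \<open>q powr (n - s * (1 + \<tau>\<psi>))\<close> and \<open>q powr (n + (n - 1) * \<tau>\<phi> -
  s * (1 + \<tau>\<psi> + \<tau>\<phi>))\<close> converge exactly when \<open>s\<close> exceeds the
  first, respectively the second, term. The same inequalities return in the lower bound: a slab of
  mass about \<open>N powr (- (n + 1))\<close> must not outweigh the cost of either of its covers.

  The obstacle in the iteration is that one redistribution loses constant factors, among them the
  density bound of the measure it starts from, which deteriorates from stage to stage. Only small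
  radii suffer from this, and there the gap between \<open>s\<close> and the dimension supplies a
  positive power of the scale, which is chosen after all these constants are known. At large radii
  the loss is a factor as close to 1 as desired. Hence the growth constants of all stages can stay
  below one fixed bound.\<close>

lemma hausdorff_gauge_empty [simp]: "hausdorff_gauge s {} = 0"
  by (simp add: hausdorff_gauge_def)

lemma hausdorff_premeasure_le:
  "U \<in> hausdorff_covers \<delta> A \<Longrightarrow> hausdorff_premeasure \<delta> s A \<le> (\<Sum>i. hausdorff_gauge s (U i))"
  unfolding hausdorff_premeasure_def by (rule INF_lower)

lemma hausdorff_premeasure_mono:
  "A \<subseteq> B \<Longrightarrow> hausdorff_premeasure \<delta> s A \<le> hausdorff_premeasure \<delta> s B"
  unfolding hausdorff_premeasure_def
  by (rule INF_superset_mono) (auto simp: hausdorff_covers_def)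

lemma hausdorff_premeasure_single:
  assumes "bounded A" "diameter A \<le> \<delta>" "0 \<le> \<delta>"
  shows "hausdorff_premeasure \<delta> s A \<le> hausdorff_gauge s A"
proof -
  let ?U = "\<lambda>i::nat. if i = 0 then A else {}"
  have "?U \<in> hausdorff_covers \<delta> A"
    using assms by (auto simp: hausdorff_covers_def)
  from hausdorff_premeasure_le[OF this]
  have "hausdorff_premeasure \<delta> s A \<le> (\<Sum>i. hausdorff_gauge s (?U i))" .
  also have "\<dots> = (\<Sum>i\<in>{0}. hausdorff_gauge s (?U i))"
    by (rule suminf_finite) auto
  finally show ?thesis by simp
qed

lemma hausdorff_premeasure_empty [simp]:
  "0 \<le> \<delta> \<Longrightarrow> hausdorff_premeasure \<delta> s {} = 0"
  using hausdorff_premeasure_single[of "{}" \<delta> s] by simp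

text \<open>Covers of the pieces, optimal up to \<open>e / 2 ^ Suc n\<close>, are merged into one
  sequence by the pairing function; the errors add up to \<open>e\<close>.\<close>

lemma hausdorff_premeasure_UN:
  fixes A :: "nat \<Rightarrow> 'a::metric_space set"
  shows "hausdorff_premeasure \<delta> s (\<Union>n. A n) \<le> (\<Sum>n. hausdorff_premeasure \<delta> s (A n))"
proof (rule ennreal_le_epsilon)
  fix e :: real assume e: "0 < e" and fin: "(\<Sum>n. hausdorff_premeasure \<delta> s (A n)) < top"
  have "\<exists>U \<in> hausdorff_covers \<delta> (A n).
      (\<Sum>i. hausdorff_gauge s (U i)) < hausdorff_premeasure \<delta> s (A n) + ennreal (e * (1/2)^Suc n)" for n
  proof -
    have "hausdorff_premeasure \<delta> s (A n) < top"
      using ennreal_suminf_lessD[OF fin] .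
    then have "hausdorff_premeasure \<delta> s (A n)
        < hausdorff_premeasure \<delta> s (A n) + ennreal (e * (1/2)^Suc n)"
      using e by (auto simp add: less_top)
    then show ?thesis
      by (subst (asm) (1) hausdorff_premeasure_def) (auto simp: INF_less_iff)
  qed
  then obtain B where B: "\<And>n. B n \<in> hausdorff_covers \<delta> (A n)"
    and Ble: "\<And>n. (\<Sum>i. hausdorff_gauge s (B n i))
        < hausdorff_premeasure \<delta> s (A n) + ennreal (e * (1/2)^Suc n)"
    by metis
  define C where "C = case_prod B o prod_decode"
  have "(\<Union>n. A n) \<subseteq> (\<Union>i. C i)"
  proof
    fix x assume "x \<in> (\<Union>n. A n)"
    then obtain n i where "x \<in> B n i" using B by (fastforce simp: hausdorff_covers_def)
    then have "x \<in> C (prod_encode (n, i))" by (simp add: C_def)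
    then show "x \<in> (\<Union>i. C i)" by blast
  qed
  then have "C \<in> hausdorff_covers \<delta> (\<Union>n. A n)"
    using B by (auto simp: hausdorff_covers_def C_def split_beta)
  then have "hausdorff_premeasure \<delta> s (\<Union>n. A n) \<le> (\<Sum>i. hausdorff_gauge s (C i))"
    by (rule hausdorff_premeasure_le)
  also have "\<dots> = (\<Sum>n. \<Sum>i. hausdorff_gauge s (B n i))"
    using suminf_ennreal_2dimen[where f="\<lambda>p. hausdorff_gauge s (case_prod B p)"
        and g="\<lambda>n. \<Sum>i. hausdorff_gauge s (B n i)"]
    by (simp add: C_def)
  also have "\<dots> \<le> (\<Sum>n. hausdorff_premeasure \<delta> s (A n) + ennreal (e * (1/2) ^ Suc n))"
    using Ble by (intro suminf_le less_imp_le) auto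
  also have "\<dots> = (\<Sum>n. hausdorff_premeasure \<delta> s (A n)) + (\<Sum>n. ennreal e * ennreal ((1/2) ^ Suc n))"
    using e by (subst suminf_add[symmetric])
               (auto simp del: ennreal_suminf_cmult simp add: ennreal_mult[symmetric])
  also have "\<dots> = (\<Sum>n. hausdorff_premeasure \<delta> s (A n)) + ennreal e"
    unfolding ennreal_suminf_cmult
    by (subst suminf_ennreal_eq[OF zero_le_power power_half_series]) auto
  finally show "hausdorff_premeasure \<delta> s (\<Union>n. A n)
      \<le> (\<Sum>n. hausdorff_premeasure \<delta> s (A n)) + ennreal e" .
qed

lemma hausdorff_premeasure_Un:
  assumes "0 \<le> \<delta>"
  shows "hausdorff_premeasure \<delta> s (A \<union> B) \<le> hausdorff_premeasure \<delta> s A + hausdorff_premeasure \<delta> s B"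
proof -
  let ?f = "\<lambda>n::nat. if n = 0 then A else if n = 1 then B else {}"
  have "A \<union> B = (\<Union>n. ?f n)"
    by (auto split: if_splits intro: exI[of _ "0::nat"] exI[of _ "1::nat"])
  then have "hausdorff_premeasure \<delta> s (A \<union> B) \<le> (\<Sum>n. hausdorff_premeasure \<delta> s (?f n))"
    using hausdorff_premeasure_UN[of \<delta> s ?f] by simp
  also have "\<dots> = (\<Sum>n\<in>{0,1}. hausdorff_premeasure \<delta> s (?f n))"
    by (rule suminf_finite) (use assms in auto)
  finally show ?thesis by simp
qed

lemma hausdorff_premeasure_finite_UN:
  assumes "0 \<le> \<delta>" "finite J" and b: "\<And>j. j \<in> J \<Longrightarrow> hausdorff_premeasure \<delta> s (V j) \<le> ennreal b"
    and "0 \<le> b"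
  shows "hausdorff_premeasure \<delta> s (\<Union>j\<in>J. V j) \<le> ennreal (real (card J) * b)"
  using assms(2) b
proof (induction J rule: finite_induct)
  case empty
  then show ?case using assms by simp
next
  case (insert j J)
  have "hausdorff_premeasure \<delta> s (\<Union>j\<in>insert j J. V j)
      \<le> hausdorff_premeasure \<delta> s (V j) + hausdorff_premeasure \<delta> s (\<Union>j\<in>J. V j)"
    using hausdorff_premeasure_Un[OF assms(1), of s "V j"] by simp
  also have "\<dots> \<le> ennreal b + ennreal (real (card J) * b)"
    using insert by (intro add_mono) auto
  also have "\<dots> = ennreal (real (card (insert j J)) * b)"
    using insert \<open>0 \<le> b\<close> by (subst ennreal_plus[symmetric]) (auto simp: algebra_simps)
  finally show ?case .
qed

lemma hausdorff_premeasure_small_set: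
  assumes "0 < s" "0 \<le> d" "d \<le> \<delta>" and d: "\<And>x y. x \<in> A \<Longrightarrow> y \<in> A \<Longrightarrow> dist x y \<le> d"
  shows "hausdorff_premeasure \<delta> s (A::'a::real_normed_vector set) \<le> ennreal (d powr s)"
proof -
  have "diameter A \<le> d"
    using assms by (intro diameter_le) (auto simp: dist_norm)
  moreover have "bounded A"
    using d unfolding bounded_two_points by blast
  moreover from this have "0 \<le> diameter A" by (rule diameter_ge_0)
  ultimately have "hausdorff_gauge s A \<le> ennreal (d powr s)"
    using assms by (auto simp: hausdorff_gauge_def intro!: ennreal_leI powr_mono2)
  moreover have "hausdorff_premeasure \<delta> s A \<le> hausdorff_gauge s A"
    using \<open>bounded A\<close> \<open>diameter A \<le> d\<close> assms by (intro hausdorff_premeasure_single) auto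
  ultimately show ?thesis by (rule order_trans[rotated])
qed

text \<open>A Borel-Cantelli argument: \<open>X\<close> is covered by every tail of the sequence,
  and the tails of the sum of \<open>g\<close> tend to 0. Only the index from which the bound holds
  may depend on \<open>\<delta>\<close>, so all premeasures of \<open>X\<close> vanish.\<close>

lemma hausdorff_measure_limsup_eq_0:
  fixes A :: "nat \<Rightarrow> 'a::metric_space set"
  assumes sum: "summable g" and g: "\<And>q. 0 \<le> g q"
    and X: "\<And>N. X \<subseteq> (\<Union>q\<in>{N..}. A q)"
    and le: "\<And>\<delta>. 0 < \<delta> \<Longrightarrow> eventually (\<lambda>q. hausdorff_premeasure \<delta> s (A q) \<le> ennreal (g q)) sequentially"
  shows "hausdorff_measure s X = 0"
proof -
  have "hausdorff_premeasure \<delta> s X \<le> 0" if \<delta>: "0 < \<delta>" for \<delta>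
  proof (rule ennreal_le_epsilon)
    fix e :: real assume e: "0 < e"
    obtain N1 where N1: "\<And>q. q \<ge> N1 \<Longrightarrow> hausdorff_premeasure \<delta> s (A q) \<le> ennreal (g q)"
      using le[OF \<delta>] by (auto simp: eventually_sequentially)
    obtain N2 where N2: "\<And>n. n \<ge> N2 \<Longrightarrow> norm (\<Sum>i. g (i + n)) < e"
      using suminf_exist_split[OF e sum] by blast
    define N where "N = max N1 N2"
    have "X \<subseteq> (\<Union>i. A (i + N))"
    proof
      fix x assume "x \<in> X"
      then obtain q where "q \<ge> N" "x \<in> A q" using X[of N] by auto
      then have "x \<in> A ((q - N) + N)" by simp
      then show "x \<in> (\<Union>i. A (i + N))" by blast
    qed
    then have "hausdorff_premeasure \<delta> s X \<le> hausdorff_premeasure \<delta> s (\<Union>i. A (i + N))"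
      by (rule hausdorff_premeasure_mono)
    also have "\<dots> \<le> (\<Sum>i. hausdorff_premeasure \<delta> s (A (i + N)))"
      by (rule hausdorff_premeasure_UN)
    also have "\<dots> \<le> (\<Sum>i. ennreal (g (i + N)))"
      by (intro suminf_le N1) (auto simp: N_def)
    also have "\<dots> = ennreal (\<Sum>i. g (i + N))"
      using sum g by (intro suminf_ennreal2) (auto simp: summable_iff_shift)
    also have "\<dots> \<le> ennreal e"
      using N2[of N] by (intro ennreal_leI) (auto simp: N_def)
    finally show "hausdorff_premeasure \<delta> s X \<le> 0 + ennreal e" by simp
  qed
  then show ?thesis
    unfolding hausdorff_measure_def by (simp add: SUP_eq_iff)
qed

section \<open>The upper bound\<close>

definition rational_point :: "int ^ 'n \<Rightarrow> nat \<Rightarrow> real ^ 'n" where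
  "rational_point p q = (\<chi> i. real_of_int (p $ i) / real q)"

definition annulus :: "real ^ 'n \<Rightarrow> real \<Rightarrow> real \<Rightarrow> (real ^ 'n) set" where
  "annulus c a b = {x. a < infnorm (x - c) \<and> infnorm (x - c) < b}"

section \<open>The maximum norm and counting of integer vectors\<close>

lemma infnorm_Max_cart: "infnorm (x::real^'n) = Max (range (\<lambda>i. \<bar>x $ i\<bar>))"
  unfolding infnorm_cart by (subst cSup_eq_Max[symmetric]) (auto intro: arg_cong[where f=Sup])

lemma infnorm_less_iff_cart: "infnorm (x::real^'n) < r \<longleftrightarrow> (\<forall>i. \<bar>x $ i\<bar> < r)"
  unfolding infnorm_Max_cart by (subst Max_less_iff) auto

lemma infnorm_le_iff_cart: "infnorm (x::real^'n) \<le> r \<longleftrightarrow> (\<forall>i. \<bar>x $ i\<bar> \<le> r)"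
  unfolding infnorm_Max_cart by (subst Max_le_iff) auto

lemma dist_le_card_mult:
  fixes x y :: "real ^ 'n"
  assumes "\<And>i. \<bar>x $ i - y $ i\<bar> \<le> d"
  shows "dist x y \<le> real CARD('n) * d"
proof -
  have "dist x y \<le> (\<Sum>i\<in>UNIV. \<bar>(x - y) $ i\<bar>)"
    unfolding dist_norm by (rule norm_le_l1_cart)
  also have "\<dots> \<le> (\<Sum>i\<in>(UNIV::'n set). d)"
    using assms by (intro sum_mono) auto
  finally show ?thesis by simp
qed

lemma finite_card_vec_components_in:
  fixes S :: "'n::finite \<Rightarrow> 'a set"
  assumes "\<And>i. finite (S i)"
  shows "finite {p :: 'a ^ 'n. \<forall>i. p $ i \<in> S i}"
    and "card {p :: 'a ^ 'n. \<forall>i. p $ i \<in> S i} \<le> (\<Prod>i\<in>UNIV. card (S i))"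
proof -
  let ?F = "PiE UNIV S"
  have eq: "{p :: 'a ^ 'n. \<forall>i. p $ i \<in> S i} = vec_lambda ` ?F"
  proof (intro equalityI subsetI)
    fix p :: "'a ^ 'n" assume "p \<in> {p. \<forall>i. p $ i \<in> S i}"
    then have "($) p \<in> ?F" by auto
    then show "p \<in> vec_lambda ` ?F" by (intro image_eqI[of _ _ "($) p"]) auto
  qed (auto simp: PiE_iff)
  have fin: "finite ?F" using assms by (intro finite_PiE) auto
  show "finite {p :: 'a ^ 'n. \<forall>i. p $ i \<in> S i}" unfolding eq using fin by blast
  show "card {p :: 'a ^ 'n. \<forall>i. p $ i \<in> S i} \<le> (\<Prod>i\<in>UNIV. card (S i))"
    unfolding eq using card_image_le[OF fin, of vec_lambda] by (simp add: card_PiE)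
qed

lemma premeasure_annulus_ball:
  fixes c :: "real ^ 'n"
  assumes "0 < s" "0 \<le> r" "2 * real CARD('n) * r \<le> \<delta>"
  shows "hausdorff_premeasure \<delta> s (annulus c a r) \<le> ennreal ((2 * real CARD('n) * r) powr s)"
proof (rule hausdorff_premeasure_small_set)
  fix x y assume xy: "x \<in> annulus c a r" "y \<in> annulus c a r"
  have "\<bar>x $ i - y $ i\<bar> \<le> 2 * r" for i
  proof -
    have "\<bar>(x - c) $ i\<bar> < r" "\<bar>(y - c) $ i\<bar> < r"
      using xy unfolding annulus_def infnorm_less_iff_cart by blast+
    then show ?thesis by (simp; linarith)
  qed
  from dist_le_card_mult[OF this] show "dist x y \<le> 2 * real CARD('n) * r" by simp
qed (use assms in auto)

text \<open>
  The annulus is cut along the \<open>2n\<close> faces of the cube, and each face slab, which has thickness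
  \<open>\<phi> * r\<close>, into cubes of that side length.
\<close>

lemma premeasure_annulus_cells:
  fixes c :: "real ^ 'n"
  assumes "0 < s" "0 < r" "0 < \<phi>" "\<phi> \<le> 1" "real CARD('n) * (\<phi> * r) \<le> \<delta>"
  shows "hausdorff_premeasure \<delta> s (annulus c ((1 - \<phi>) * r) r)
    \<le> ennreal (2 * real CARD('n) * ((4 / \<phi>) ^ (CARD('n) - 1) * (real CARD('n) * (\<phi> * r)) powr s))"
proof -
  define h where "h = \<phi> * r"
  have h: "0 < h" using assms by (simp add: h_def)
  have \<delta>: "0 \<le> \<delta>"
    using assms(5) h by (auto simp: h_def[symmetric] intro: order_trans[of 0 "real CARD('n) * h"])
  \<comment> \<open>On the annulus every coordinate of \<open>x - c\<close> is below
    \<open>r\<close> in absolute value and \<open>r / h = 1 / \<phi>\<close>, so \<open>Z\<close>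
    contains all grid indices that occur.\<close>
  define Z where "Z = {\<lfloor>- (1/\<phi>)\<rfloor>..\<lfloor>1/\<phi>\<rfloor>}"
  have cardZ: "real (card Z) \<le> 4 / \<phi>"
  proof -
    have "real (card Z) \<le> 2 * (1/\<phi>) + 2"
    proof -
      have "\<lfloor>- (1/\<phi>)\<rfloor> \<le> \<lfloor>1/\<phi>\<rfloor>" using assms by (intro floor_mono) auto
      then have "real (card Z) = real_of_int (\<lfloor>1/\<phi>\<rfloor> - \<lfloor>- (1/\<phi>)\<rfloor> + 1)"
        unfolding Z_def card_atLeastAtMost_int by simp
      then show ?thesis by linarith
    qed
    also have "\<dots> \<le> 4 / \<phi>" using assms by (simp add: field_simps)
    finally show ?thesis .
  qed
  define J where "J = (\<lambda>i::'n. PiE (UNIV - {i}) (\<lambda>_. Z))"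
  have J: "finite (J i)" "real (card (J i)) \<le> (4 / \<phi>) ^ (CARD('n) - 1)" for i
  proof -
    show "finite (J i)" by (auto simp: J_def Z_def intro!: finite_PiE)
    have "card (J i) = card Z ^ (CARD('n) - 1)"
      by (simp add: J_def card_PiE card_Diff_singleton)
    then show "real (card (J i)) \<le> (4 / \<phi>) ^ (CARD('n) - 1)"
      using cardZ by (simp add: power_mono)
  qed
  \<comment> \<open>\<open>i\<close> is the direction of the face and \<open>\<sigma>\<close> its
    sign. In direction \<open>i\<close> the slab is a single cell wide, so \<open>z\<close> indexes
    only the other coordinates.\<close>
  define V where "V = (\<lambda>(i, \<sigma>) z. {x :: real ^ 'n. (1 - \<phi>) * r < \<sigma> * (x - c) $ i \<and> \<sigma> * (x - c) $ i < r
      \<and> (\<forall>j. j \<noteq> i \<longrightarrow> \<lfloor>(x - c) $ j / h\<rfloor> = z j)})"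
  have V: "hausdorff_premeasure \<delta> s (V (i, \<sigma>) z) \<le> ennreal ((real CARD('n) * h) powr s)"
    if "\<sigma> \<in> {-1, 1}" for i \<sigma> z
  proof (rule hausdorff_premeasure_small_set)
    fix x y assume xy: "x \<in> V (i, \<sigma>) z" "y \<in> V (i, \<sigma>) z"
    have "\<bar>x $ j - y $ j\<bar> \<le> h" for j
    proof (cases "j = i")
      case True
      show ?thesis using xy that by (auto simp: V_def True h_def algebra_simps abs_le_iff)
    next
      case False
      then have "\<lfloor>(x - c) $ j / h\<rfloor> = \<lfloor>(y - c) $ j / h\<rfloor>"
        using xy by (auto simp: V_def)
      then have "\<bar>(x - c) $ j / h - (y - c) $ j / h\<bar> \<le> 1" by linarith
      then have "\<bar>((x - c) $ j - (y - c) $ j) / h\<bar> \<le> 1" by (simp add: diff_divide_distrib)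
      then show ?thesis using h by (simp add: abs_divide)
    qed
    from dist_le_card_mult[OF this] show "dist x y \<le> real CARD('n) * h" .
  qed (use assms h in \<open>auto simp: h_def\<close>)
  have sub: "annulus c ((1 - \<phi>) * r) r \<subseteq> (\<Union>i\<sigma> \<in> UNIV \<times> {-1, 1}. \<Union>z\<in>J (fst i\<sigma>). V i\<sigma> z)"
  proof
    fix x assume x: "x \<in> annulus c ((1 - \<phi>) * r) r"
    define u where "u = x - c"
    have u: "\<bar>u $ j\<bar> < r" for j
      using x unfolding annulus_def infnorm_less_iff_cart u_def by blast
    have "\<not> (\<forall>i. \<bar>u $ i\<bar> \<le> (1 - \<phi>) * r)"
      using x unfolding annulus_def infnorm_le_iff_cart[symmetric] u_def by simp
    then obtain i where i: "(1 - \<phi>) * r < \<bar>u $ i\<bar>" by (auto simp: not_le)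
    define \<sigma> :: real where "\<sigma> = (if u $ i < 0 then -1 else 1)"
    have \<sigma>: "\<sigma> \<in> {-1, 1}" "\<sigma> * u $ i = \<bar>u $ i\<bar>" by (auto simp: \<sigma>_def)
    define z where "z = restrict (\<lambda>j. \<lfloor>u $ j / h\<rfloor>) (UNIV - {i})"
    have "\<lfloor>u $ j / h\<rfloor> \<in> Z" for j
    proof -
      have "\<bar>u $ j / h\<bar> \<le> 1 / \<phi>"
        using u[of j] assms by (simp add: h_def abs_mult field_simps)
      then have "- (1/\<phi>) \<le> u $ j / h" "u $ j / h \<le> 1/\<phi>" by linarith+
      then show ?thesis unfolding Z_def by (simp add: floor_mono)
    qed
    then have "z \<in> J i" by (auto simp: z_def J_def)
    moreover have "x \<in> V (i, \<sigma>) z"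
      using i u[of i] \<sigma> by (auto simp: V_def u_def[symmetric] z_def simp del: vector_minus_component)
    ultimately show "x \<in> (\<Union>i\<sigma> \<in> UNIV \<times> {-1, 1}. \<Union>z\<in>J (fst i\<sigma>). V i\<sigma> z)"
      using \<sigma> by (intro UN_I[of "(i, \<sigma>)"] UN_I[of z]) auto
  qed
  have inner: "hausdorff_premeasure \<delta> s (\<Union>z\<in>J (fst i\<sigma>). V i\<sigma> z)
      \<le> ennreal ((4 / \<phi>) ^ (CARD('n) - 1) * (real CARD('n) * h) powr s)"
    if "i\<sigma> \<in> UNIV \<times> {-1, 1}" for i\<sigma>
  proof -
    obtain i \<sigma> where eq: "i\<sigma> = (i, \<sigma>)" "\<sigma> \<in> {-1, 1}" using \<open>i\<sigma> \<in> UNIV \<times> {-1, 1}\<close> by auto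
    have "hausdorff_premeasure \<delta> s (\<Union>z\<in>J i. V (i, \<sigma>) z)
        \<le> ennreal (real (card (J i)) * (real CARD('n) * h) powr s)"
      by (intro hausdorff_premeasure_finite_UN V J \<delta> eq) auto
    also have "\<dots> \<le> ennreal ((4 / \<phi>) ^ (CARD('n) - 1) * (real CARD('n) * h) powr s)"
      by (intro ennreal_leI mult_right_mono J) auto
    finally show ?thesis by (simp add: eq)
  qed
  have "hausdorff_premeasure \<delta> s (annulus c ((1 - \<phi>) * r) r)
      \<le> hausdorff_premeasure \<delta> s (\<Union>i\<sigma> \<in> (UNIV::'n set) \<times> {-1, 1::real}. \<Union>z\<in>J (fst i\<sigma>). V i\<sigma> z)"
    using sub by (rule hausdorff_premeasure_mono)
  also have "\<dots> \<le> ennreal (real (card ((UNIV::'n set) \<times> {-1, 1::real}))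
      * ((4 / \<phi>) ^ (CARD('n) - 1) * (real CARD('n) * h) powr s))"
    using assms by (intro hausdorff_premeasure_finite_UN inner \<delta>) auto
  also have "card ((UNIV::'n set) \<times> {-1, 1::real}) = CARD('n) * 2"
    by (simp add: card_cartesian_product)
  finally show ?thesis by (simp add: h_def mult.commute[of _ 2])
qed

text \<open>\<open>e\<close> is the decay exponent of the cost of one annulus. As
  \<open>\<psi> q / q \<le> 1\<close>, points of the unit cube only meet annuli with numerators
  between \<open>- q\<close> and \<open>2 * q\<close>; these are of order \<open>q ^ n\<close> many,
  and \<open>q powr (n - e)\<close> is summable.\<close>

lemma hausdorff_measure_W_eq_0:
  fixes \<psi> \<phi> :: "nat \<Rightarrow> real"
  assumes \<psi>: "\<And>q. 1 \<le> q \<Longrightarrow> \<psi> q \<le> real q"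
    and e: "e > real CARD('n) + 1" and C: "0 \<le> C"
    and bd: "\<And>\<delta>. 0 < \<delta> \<Longrightarrow> eventually (\<lambda>q. \<forall>p. hausdorff_premeasure \<delta> s
       (annulus (rational_point p q :: real^'n) ((1 - \<phi> q) * (\<psi> q / real q)) (\<psi> q / real q))
        \<le> ennreal (C * real q powr (- e))) sequentially"
  shows "hausdorff_measure s (W \<psi> \<phi> :: (real ^ 'n) set) = 0"
proof -
  define P where "P = (\<lambda>q. {p :: int^'n. \<forall>i. p $ i \<in> {- int q..2 * int q}})"
  have P: "finite (P q)" "card (P q) \<le> (3 * q + 1) ^ CARD('n)" for q
  proof -
    have *: "card {- int q..2 * int q} = 3 * q + 1" by simp
    show "finite (P q)" "card (P q) \<le> (3 * q + 1) ^ CARD('n)"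
      using finite_card_vec_components_in[of "\<lambda>_::'n. {- int q..2 * int q}"]
      unfolding P_def * by auto
  qed
  define ann where "ann = (\<lambda>p q. annulus (rational_point p q :: real^'n)
     ((1 - \<phi> q) * (\<psi> q / real q)) (\<psi> q / real q))"
  define A where "A = (\<lambda>q. \<Union>p\<in>P q. ann p q)"
  define g where "g = (\<lambda>q. 4 ^ CARD('n) * C * real q powr (real CARD('n) - e))"
  show ?thesis
  proof (rule hausdorff_measure_limsup_eq_0)
    show "summable g"
      unfolding g_def using e by (intro summable_mult) (simp add: summable_real_powr_iff)
    show "0 \<le> g q" for q using C by (simp add: g_def)
    show "W \<psi> \<phi> \<subseteq> (\<Union>q\<in>{N..}. A q)" for N
    proof
      fix x :: "real^'n" assume x: "x \<in> W \<psi> \<phi>"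
      define X where "X = {(p, q). 1 \<le> q \<and> x \<in> ann p q}"
      have inf: "infinite X"
        using x by (simp add: W_def X_def ann_def annulus_def rational_point_def conj_assoc)
      have XP: "p \<in> P q" if "(p, q) \<in> X" for p q
      proof -
        have q: "1 \<le> q" and less: "\<And>i. \<bar>(x - rational_point p q) $ i\<bar> < \<psi> q / real q"
          using that by (auto simp: X_def ann_def annulus_def infnorm_less_iff_cart)
        have "p $ i \<in> {- int q..2 * int q}" for i
        proof -
          have "\<bar>x $ i - real_of_int (p $ i) / real q\<bar> < \<psi> q / real q"
            using less[of i] by (simp add: rational_point_def)
          also have "\<dots> \<le> 1" using \<psi>[OF q] q by (simp add: divide_le_eq)
          finally have "\<bar>x $ i - real_of_int (p $ i) / real q\<bar> < 1" .
          moreover have "0 \<le> x $ i" "x $ i \<le> 1" using x by (auto simp: W_def)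
          ultimately have "-1 < real_of_int (p $ i) / real q" "real_of_int (p $ i) / real q < 2"
            by linarith+
          then have "- real q < real_of_int (p $ i)" "real_of_int (p $ i) < 2 * real q"
            using q by (auto simp: field_simps)
          then show ?thesis by simp
        qed
        then show ?thesis by (auto simp: P_def)
      qed
      \<comment> \<open>Each \<open>q\<close> admits finitely many numerators, so infinitely many
        pairs force unbounded denominators.\<close>
      have "\<exists>p q. (p, q) \<in> X \<and> N \<le> q"
      proof (rule ccontr)
        assume "\<not> ?thesis"
        then have "X \<subseteq> (\<Union>q\<in>{..<N}. P q \<times> {q})"
          using XP by (fastforce simp: not_le)
        then show False using inf P by (meson finite_SigmaI finite_UN finite_lessThan finite.intros finite_subset)
      qed
      then obtain p q where "(p, q) \<in> X" "N \<le> q" by blast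
      with XP[of p q] show "x \<in> (\<Union>q\<in>{N..}. A q)" by (auto simp: A_def X_def)
    qed
    fix \<delta> :: real assume \<delta>: "0 < \<delta>"
    show "eventually (\<lambda>q. hausdorff_premeasure \<delta> s (A q) \<le> ennreal (g q)) sequentially"
      using bd[OF \<delta>] eventually_ge_at_top[of "1::nat"]
    proof eventually_elim
      case (elim q)
      have "hausdorff_premeasure \<delta> s (A q) \<le> ennreal (real (card (P q)) * (C * real q powr (- e)))"
        unfolding A_def using \<delta> P elim C
        by (intro hausdorff_premeasure_finite_UN) (auto simp: ann_def)
      also have "\<dots> \<le> ennreal ((4 * real q) ^ CARD('n) * (C * real q powr (- e)))"
      proof (intro ennreal_leI mult_right_mono)
        have "real (card (P q)) \<le> real ((3 * q + 1) ^ CARD('n))"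
          using P(2)[of q] by (rule of_nat_mono)
        also have "\<dots> = real (3 * q + 1) ^ CARD('n)" by simp
        also have "\<dots> \<le> (4 * real q) ^ CARD('n)"
          using elim by (intro power_mono) auto
        finally show "real (card (P q)) \<le> (4 * real q) ^ CARD('n)" .
      qed (use C in auto)
      also have "(4 * real q) ^ CARD('n) * (C * real q powr (- e)) = g q"
        using elim by (simp add: g_def power_mult_distrib powr_diff powr_minus_divide powr_realpow)
      finally show ?case .
    qed
  qed
qed

text \<open>Each disjunct of \<open>big\<close> belongs to one cover. One cube per annulus gives the
  exponent \<open>s * (1 + \<tau>\<psi>)\<close>; cubes of the thickness give
  \<open>s * (1 + \<tau>\<psi> + \<tau>\<phi>)\<close>, reduced by
  \<open>(n - 1) * \<tau>\<phi>\<close> for their number.\<close>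

lemma hausdorff_measure_W_eq_0_of_dim_less:
  fixes \<tau>\<psi> \<tau>\<phi> s :: real and \<psi> \<phi> :: "nat \<Rightarrow> real"
  assumes \<tau>: "0 \<le> \<tau>\<phi>" "0 \<le> \<tau>\<psi>" and s: "0 < s"
    and \<psi>: "\<And>q. 1 \<le> q \<Longrightarrow> \<psi> q = real q powr (- \<tau>\<psi>)"
    and \<phi>: "\<And>q. 1 \<le> q \<Longrightarrow> \<phi> q = real q powr (- \<tau>\<phi>)"
    and big: "real CARD('n) + 1 < s * (1 + \<tau>\<psi>) \<or>
       real CARD('n) + 1 + (real CARD('n) - 1) * \<tau>\<phi> < s * (1 + \<tau>\<psi> + \<tau>\<phi>)"
  shows "hausdorff_measure s (W \<psi> \<phi> :: (real ^ 'n) set) = 0"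
proof -
  let ?n = "real CARD('n)"
  have r: "\<psi> q / real q = real q powr (- 1 - \<tau>\<psi>)" if "1 \<le> q" for q
    using that \<psi> by (simp add: powr_diff powr_minus_divide)
  have small: "eventually (\<lambda>q. K * real q powr (- t) \<le> \<delta>) sequentially" if "0 < t" "0 < \<delta>" for K t \<delta>
  proof -
    have "((\<lambda>q. K * real q powr (- t)) \<longlongrightarrow> K * 0) sequentially"
      using \<open>0 < t\<close> by (intro tendsto_mult tendsto_const tendsto_neg_powr filterlim_real_sequentially) auto
    then have "eventually (\<lambda>q. K * real q powr (- t) < \<delta>) sequentially"
      using that by (intro order_tendstoD) auto
    then show ?thesis by (rule eventually_mono) simp
  qed
  have le1: "\<psi> q \<le> real q" if "1 \<le> q" for q
  proof -
    have "real q powr (- \<tau>\<psi>) \<le> real q powr 1"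
      using that \<tau> by (intro powr_mono) auto
    then show ?thesis using that \<psi> by simp
  qed
  from big show ?thesis
  proof
    assume big: "?n + 1 < s * (1 + \<tau>\<psi>)"
    show ?thesis
    proof (rule hausdorff_measure_W_eq_0[OF le1 big])
      show "0 \<le> (2 * ?n) powr s" by simp
      fix \<delta> :: real assume \<delta>: "0 < \<delta>"
      have "0 < 1 + \<tau>\<psi>" using \<tau> by simp
      from small[OF this \<delta>, of "2 * ?n"] eventually_ge_at_top[of "1::nat"]
      show "eventually (\<lambda>q. \<forall>p. hausdorff_premeasure \<delta> s (annulus (rational_point p q :: real^'n)
          ((1 - \<phi> q) * (\<psi> q / real q)) (\<psi> q / real q))
          \<le> ennreal ((2 * ?n) powr s * real q powr (- (s * (1 + \<tau>\<psi>))))) sequentially"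
      proof eventually_elim
        case (elim q)
        have "(2 * ?n * (\<psi> q / real q)) powr s = (2 * ?n) powr s * real q powr (- (s * (1 + \<tau>\<psi>)))"
          using elim by (simp add: r powr_mult powr_powr algebra_simps)
        moreover have "2 * ?n * (\<psi> q / real q) \<le> \<delta>" "0 \<le> \<psi> q / real q"
          using elim by (auto simp: r)
        ultimately show ?case
          using premeasure_annulus_ball[OF s, of "\<psi> q / real q" \<delta>, where 'n='n] by auto
      qed
    qed
  next
    assume "?n + 1 + (?n - 1) * \<tau>\<phi> < s * (1 + \<tau>\<psi> + \<tau>\<phi>)"
    then have big: "?n + 1 < s * (1 + \<tau>\<psi> + \<tau>\<phi>) - (?n - 1) * \<tau>\<phi>" by simp
    let ?C = "2 * ?n * (4 ^ (CARD('n) - 1) * ?n powr s)"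
    show ?thesis
    proof (rule hausdorff_measure_W_eq_0[OF le1 big])
      show "0 \<le> ?C" by simp
      fix \<delta> :: real assume \<delta>: "0 < \<delta>"
      have "0 < 1 + \<tau>\<psi> + \<tau>\<phi>" using \<tau> by simp
      from small[OF this \<delta>, of ?n] eventually_ge_at_top[of "1::nat"]
      show "eventually (\<lambda>q. \<forall>p. hausdorff_premeasure \<delta> s (annulus (rational_point p q :: real^'n)
          ((1 - \<phi> q) * (\<psi> q / real q)) (\<psi> q / real q))
          \<le> ennreal (?C * real q powr (- (s * (1 + \<tau>\<psi> + \<tau>\<phi>) - (?n - 1) * \<tau>\<phi>)))) sequentially"
      proof eventually_elim
        case (elim q)
        have \<phi>r: "\<phi> q * (\<psi> q / real q) = real q powr (- (1 + \<tau>\<psi> + \<tau>\<phi>))"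
          using elim by (simp add: r \<phi> powr_add[symmetric] algebra_simps)
        have "(4 / \<phi> q) ^ (CARD('n) - 1) = 4 ^ (CARD('n) - 1) * (real q powr \<tau>\<phi>) ^ (CARD('n) - 1)"
          using elim by (simp add: \<phi> powr_minus_divide power_divide power_mult_distrib)
        also have "(real q powr \<tau>\<phi>) ^ (CARD('n) - 1) = real q powr ((?n - 1) * \<tau>\<phi>)"
          using elim by (simp add: powr_realpow[symmetric] powr_powr of_nat_diff mult.commute)
        finally have cells: "(4 / \<phi> q) ^ (CARD('n) - 1) = 4 ^ (CARD('n) - 1) * real q powr ((?n - 1) * \<tau>\<phi>)" .
        have "2 * ?n * ((4 / \<phi> q) ^ (CARD('n) - 1) * (?n * (\<phi> q * (\<psi> q / real q))) powr s)
          = ?C * (real q powr ((?n - 1) * \<tau>\<phi>) * real q powr (- (s * (1 + \<tau>\<psi> + \<tau>\<phi>))))"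
          unfolding \<phi>r cells by (simp add: powr_mult powr_powr algebra_simps)
        also have "\<dots> = ?C * real q powr (- (s * (1 + \<tau>\<psi> + \<tau>\<phi>) - (?n - 1) * \<tau>\<phi>))"
          by (simp add: powr_add[symmetric])
        finally have eq: "2 * ?n * ((4 / \<phi> q) ^ (CARD('n) - 1) * (?n * (\<phi> q * (\<psi> q / real q))) powr s)
          = ?C * real q powr (- (s * (1 + \<tau>\<psi> + \<tau>\<phi>) - (?n - 1) * \<tau>\<phi>))" .
        have cell_small: "?n * (\<phi> q * (\<psi> q / real q)) \<le> \<delta>" using elim unfolding \<phi>r by simp
        have "0 < \<phi> q" "\<phi> q \<le> 1" "0 < \<psi> q / real q"
          using elim \<tau> by (auto simp: \<phi> r powr_minus_divide ge_one_powr_ge_zero)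
        from premeasure_annulus_cells[OF s this(3,1,2) cell_small] show ?case
          unfolding eq by blast
      qed
    qed
  qed
qed

section \<open>Separated rational points\<close>

definition cube :: "real ^ 'n \<Rightarrow> real \<Rightarrow> (real ^ 'n) set" where
  "cube x d = {y. \<forall>i. \<bar>y $ i - x $ i\<bar> \<le> d}"

lemma cube_eq_cbox: "cube x d = cbox (\<chi> i. x $ i - d) (\<chi> i. x $ i + d)"
  by (auto simp: cube_def mem_box_cart abs_le_iff algebra_simps)

lemma cube_sets [measurable]: "cube x d \<in> sets borel"
  by (simp add: cube_eq_cbox)

lemma measure_cube:
  assumes "0 \<le> d" shows "measure lborel (cube (x::real^'n) d) = (2 * d) ^ CARD('n)"
proof -
  have "x \<in> cube x d" using assms by (simp add: cube_def)
  then show ?thesis unfolding cube_eq_cbox by (subst content_cbox_cart) auto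
qed

lemma emeasure_lborel_cube_finite: "emeasure lborel (cube x d) \<noteq> \<infinity>"
  unfolding cube_eq_cbox using emeasure_lborel_cbox_finite less_imp_neq by blast

lemma fmeasurable_cube: "cube x d \<in> fmeasurable lborel"
  by (simp add: cube_eq_cbox)

text \<open>Simultaneous approximation of the coordinates, transported to the index type by the
  enumeration \<open>h\<close> and divided by \<open>q\<close>.\<close>

lemma dirichlet_rational_point:
  fixes x :: "real ^ 'n"
  assumes "1 \<le> m"
  obtains q p where "1 \<le> q" "q \<le> m ^ CARD('n)" "x \<in> cube (rational_point p q) (1 / (real q * real m))"
proof -
  obtain h :: "nat \<Rightarrow> 'n" where h: "bij_betw h {0..<CARD('n)} UNIV"
    using ex_bij_betw_nat_finite[OF finite_class.finite_UNIV] by blast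
  obtain q' p' where q': "0 < q'" "q' \<le> int (m ^ CARD('n))"
    and p': "\<And>i. i < CARD('n) \<Longrightarrow> \<bar>of_int q' * x $ h i - of_int (p' i)\<bar> < 1 / real m"
    using Dirichlet_approx_simult[of m "CARD('n)" "\<lambda>i. x $ h i"] assms by auto
  define q where "q = nat q'"
  define p where "p = (\<chi> i. p' (inv_into {0..<CARD('n)} h i))"
  have q: "1 \<le> q" "q \<le> m ^ CARD('n)" using q' by (auto simp: q_def nat_le_iff)
  have "\<bar>x $ i - real_of_int (p $ i) / real q\<bar> \<le> 1 / (real q * real m)" for i
  proof -
    define k where "k = inv_into {0..<CARD('n)} h i"
    have "h k = i" "k \<in> {0..<CARD('n)}"
      using h unfolding k_def bij_betw_def
      by (metis UNIV_I f_inv_into_f, metis UNIV_I inv_into_into)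
    with p'[of k] have "\<bar>real q * x $ i - of_int (p $ i)\<bar> < 1 / real m"
      using q' by (auto simp: p_def k_def q_def)
    moreover have "x $ i - real_of_int (p $ i) / real q = (real q * x $ i - of_int (p $ i)) / real q"
      using q by (simp add: field_simps)
    ultimately show ?thesis
      using q by (simp add: abs_divide divide_le_eq mult.commute)
  qed
  then show ?thesis using q by (intro that[of q p]) (auto simp: cube_def rational_point_def)
qed

text \<open>The widening by 1 at both ends accounts for numerators \<open>p\<close> with
  \<open>p / q\<close> within \<open>1 / q\<close> of a point of the cube.\<close>

lemma card_ceiling_floor_le:
  fixes a b :: real
  assumes "a \<le> b"
  shows "real (card {\<lceil>a - 1\<rceil>..\<lfloor>b + 1\<rfloor>}) \<le> b - a + 3"
proof -
  have "\<lceil>a - 1\<rceil> \<le> \<lfloor>b + 1\<rfloor> + 1" using assms by linarith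
  then have "real (card {\<lceil>a - 1\<rceil>..\<lfloor>b + 1\<rfloor>}) = real_of_int (\<lfloor>b + 1\<rfloor> - \<lceil>a - 1\<rceil> + 1)"
    unfolding card_atLeastAtMost_int by simp
  also have "\<dots> \<le> b - a + 3" by linarith
  finally show ?thesis .
qed

text \<open>
  Small denominators contribute little to the Dirichlet cover: there are about \<open>(q\<eta>)\<^sup>n\<close> points with
  denominator \<open>q\<close> near a cube of side \<open>\<eta>\<close>, and their balls have volume comparable to \<open>(qm)\<close> to the
  power \<open>-n\<close>, so each \<open>q\<close> covers a proportion of about \<open>m\<close> to the power \<open>-n\<close>.
\<close>

lemma measure_small_denominators:
  fixes y :: "real ^ 'n"
  assumes \<eta>: "0 < \<eta>" "\<eta> \<le> 1" and m: "1 \<le> m"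
  obtains B where "B \<in> fmeasurable lborel"
    "measure lborel B \<le> (real M * (2 * \<eta>) ^ CARD('n) + 7 ^ CARD('n) * (6 / \<eta>)) / real (m ^ CARD('n))"
    "\<And>x p q. x \<in> cube y (\<eta> / 4) \<Longrightarrow> 1 \<le> q \<Longrightarrow> q \<le> M \<Longrightarrow>
        x \<in> cube (rational_point p q) (1 / (real q * real m)) \<Longrightarrow> x \<in> B"
proof -
  let ?n = "CARD('n)"
  define T where "T = (\<lambda>q i. {\<lceil>real q * (y $ i - \<eta> / 4) - 1\<rceil>..\<lfloor>real q * (y $ i + \<eta> / 4) + 1\<rfloor>})"
  define P where "P = (\<lambda>q. {p :: int ^ 'n. \<forall>i. p $ i \<in> T q i})"
  define C where "C = (\<lambda>q p. cube (rational_point p q :: real^'n) (1 / (real q * real m)))"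
  define B where "B = (\<Union>q\<in>{1..M}. \<Union>p\<in>P q. C q p)"
  have cardT: "real (card (T q i)) \<le> real q * \<eta> / 2 + 3" for q i
  proof -
    have "real q * (y $ i - \<eta> / 4) \<le> real q * (y $ i + \<eta> / 4)"
      using \<eta> by (intro mult_left_mono) auto
    then have "real (card (T q i)) \<le> real q * (y $ i + \<eta> / 4) - real q * (y $ i - \<eta> / 4) + 3"
      unfolding T_def by (rule card_ceiling_floor_le)
    then show ?thesis by (simp add: algebra_simps)
  qed
  have finP: "finite (P q)" for q
    unfolding P_def by (rule finite_card_vec_components_in) (simp add: T_def)
  have cardP: "real (card (P q)) \<le> (real q * \<eta> / 2 + 3) ^ ?n" for q
  proof -
    have "real (card (P q)) \<le> real (\<Prod>i\<in>(UNIV::'n set). card (T q i))"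
      unfolding P_def by (intro of_nat_mono finite_card_vec_components_in) (simp add: T_def)
    also have "\<dots> \<le> (\<Prod>i\<in>(UNIV::'n set). real q * \<eta> / 2 + 3)"
      unfolding of_nat_prod by (intro prod_mono) (auto simp: cardT)
    finally show ?thesis by simp
  qed
  have fm: "C q p \<in> fmeasurable lborel" for q p by (simp add: C_def fmeasurable_cube)
  then have fmU: "(\<Union>p\<in>P q. C q p) \<in> fmeasurable lborel" for q
    by (intro fmeasurable.finite_UN finP) auto
  show ?thesis
  proof (rule that[of B])
    show "B \<in> fmeasurable lborel"
      unfolding B_def by (intro fmeasurable.finite_UN fmU) auto
    have "measure lborel B \<le> (\<Sum>q\<in>{1..M}. measure lborel (\<Union>p\<in>P q. C q p))"
      unfolding B_def by (intro measure_UNION_le fmeasurableD fmU) auto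
    \<comment> \<open>Each \<open>q\<close> contributes at most
      \<open>(\<eta> + 6 / q) ^ n / m ^ n\<close>. For \<open>q \<ge> 6 / \<eta>\<close> the base is
      at most \<open>2 * \<eta>\<close>; the at most \<open>6 / \<eta>\<close> other
      \<open>q\<close> get the crude base 7.\<close>
    also have "\<dots> \<le> (\<Sum>q\<in>{1..M}. ((2 * \<eta>) ^ ?n + (if real q < 6 / \<eta> then 7 ^ ?n else 0)) / real (m ^ ?n))"
    proof (rule sum_mono)
      fix q assume q: "q \<in> {1..M}"
      have "measure lborel (\<Union>p\<in>P q. C q p) \<le> (\<Sum>p\<in>P q. measure lborel (C q p))"
        by (intro measure_UNION_le fmeasurableD fm finP)
      also have "\<dots> = real (card (P q)) * (2 / (real q * real m)) ^ ?n"
        by (simp add: C_def measure_cube)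
      also have "\<dots> \<le> (real q * \<eta> / 2 + 3) ^ ?n * (2 / (real q * real m)) ^ ?n"
        by (intro mult_right_mono cardP) auto
      also have "\<dots> = ((\<eta> + 6 / real q) / real m) ^ ?n"
        unfolding power_mult_distrib[symmetric] using q m
        by (intro arg_cong2[where f=power]) (auto simp: field_simps)
      also have "\<dots> = (\<eta> + 6 / real q) ^ ?n / real (m ^ ?n)"
        by (simp add: power_divide)
      also have "\<dots> \<le> ((2 * \<eta>) ^ ?n + (if real q < 6 / \<eta> then 7 ^ ?n else 0)) / real (m ^ ?n)"
      proof (intro divide_right_mono)
        show "(\<eta> + 6 / real q) ^ ?n \<le> (2 * \<eta>) ^ ?n + (if real q < 6 / \<eta> then 7 ^ ?n else 0)"
        proof (cases "real q < 6 / \<eta>")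
          case True
          have "\<eta> + 6 / real q \<le> 7"
          proof -
            have "6 / real q \<le> 6" using q by (simp add: divide_le_eq)
            then show ?thesis using \<eta> by linarith
          qed
          then have "(\<eta> + 6 / real q) ^ ?n \<le> 7 ^ ?n" using \<eta> by (intro power_mono) auto
          moreover have "0 \<le> (2 * \<eta>) ^ ?n" using \<eta> by simp
          ultimately show ?thesis using True by simp
        next
          case False
          then have "6 / real q \<le> \<eta>" using \<eta> q by (auto simp: field_simps)
          then have "(\<eta> + 6 / real q) ^ ?n \<le> (2 * \<eta>) ^ ?n" using \<eta> by (intro power_mono) auto
          with False show ?thesis by simp
        qed
      qed auto
      finally show "measure lborel (\<Union>p\<in>P q. C q p)
        \<le> ((2 * \<eta>) ^ ?n + (if real q < 6 / \<eta> then 7 ^ ?n else 0)) / real (m ^ ?n)" .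
    qed
    also have "\<dots> = (real M * (2 * \<eta>) ^ ?n + 7 ^ ?n * real (card {q\<in>{1..M}. real q < 6 / \<eta>})) / real (m ^ ?n)"
      by (simp add: sum_divide_distrib[symmetric] sum.distrib sum.If_cases Int_def mult.commute)
    also have "\<dots> \<le> (real M * (2 * \<eta>) ^ ?n + 7 ^ ?n * (6 / \<eta>)) / real (m ^ ?n)"
    proof (intro divide_right_mono add_left_mono mult_left_mono)
      have "{q\<in>{1..M}. real q < 6 / \<eta>} \<subseteq> {1..nat \<lfloor>6 / \<eta>\<rfloor>}"
        by (auto intro!: le_nat_floor)
      then have "card {q\<in>{1..M}. real q < 6 / \<eta>} \<le> nat \<lfloor>6 / \<eta>\<rfloor>"
        using card_mono[of "{1..nat \<lfloor>6 / \<eta>\<rfloor>}"] by fastforce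
      also have "real \<dots> \<le> 6 / \<eta>" using \<eta> by simp
      finally show "real (card {q\<in>{1..M}. real q < 6 / \<eta>}) \<le> 6 / \<eta>" by simp
    qed auto
    finally show "measure lborel B \<le> (real M * (2 * \<eta>) ^ ?n + 7 ^ ?n * (6 / \<eta>)) / real (m ^ ?n)" .
  next
    fix x p q assume x: "x \<in> cube y (\<eta> / 4)" and q: "1 \<le> q" "q \<le> M"
      and xp: "x \<in> cube (rational_point p q) (1 / (real q * real m))"
    have "p $ i \<in> T q i" for i
    proof -
      have "\<bar>x $ i - real_of_int (p $ i) / real q\<bar> \<le> 1 / (real q * real m)"
        using xp by (simp add: cube_def rational_point_def)
      also have "\<dots> \<le> 1 / real q" using q m by (simp add: field_simps)
      finally have "\<bar>x $ i - real_of_int (p $ i) / real q\<bar> \<le> 1 / real q" .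
      then have "real q * \<bar>x $ i - real_of_int (p $ i) / real q\<bar> \<le> 1"
        using q by (simp add: field_simps)
      then have "\<bar>real q * (x $ i - real_of_int (p $ i) / real q)\<bar> \<le> 1"
        by (simp add: abs_mult)
      then have 1: "\<bar>real q * x $ i - real_of_int (p $ i)\<bar> \<le> 1"
        using q by (simp add: algebra_simps)
      have "\<bar>x $ i - y $ i\<bar> \<le> \<eta> / 4" using x by (simp add: cube_def)
      then have "y $ i - \<eta> / 4 \<le> x $ i" "x $ i \<le> y $ i + \<eta> / 4" by linarith+
      then have "real q * (y $ i - \<eta> / 4) \<le> real q * x $ i" "real q * x $ i \<le> real q * (y $ i + \<eta> / 4)"
        by (auto intro!: mult_left_mono)
      with 1 have "real q * (y $ i - \<eta> / 4) - 1 \<le> real_of_int (p $ i)"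
         "real_of_int (p $ i) \<le> real q * (y $ i + \<eta> / 4) + 1" by linarith+
      then show ?thesis unfolding T_def atLeastAtMost_iff ceiling_le_iff le_floor_iff by blast
    qed
    then have "p \<in> P q" "x \<in> C q p" using xp by (auto simp: P_def C_def)
    then show "x \<in> B" using q unfolding B_def by (intro UN_I[of q] UN_I[of p]) auto
  qed
qed

text \<open>Greedy choice: a new point joins \<open>S\<close> unless it is already closer than
  \<open>\<rho>\<close> to it. With \<open>0 < \<rho>\<close> a chosen point covers itself.\<close>

lemma maximal_separated_subset:
  fixes T :: "(real ^ 'n) set"
  assumes "finite T"
  obtains S where "S \<subseteq> T" "\<And>c c'. c \<in> S \<Longrightarrow> c' \<in> S \<Longrightarrow> c \<noteq> c' \<Longrightarrow> \<rho> \<le> infnorm (c - c')"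
    "\<And>c. c \<in> T \<Longrightarrow> 0 < \<rho> \<Longrightarrow> \<exists>c'\<in>S. infnorm (c - c') < \<rho>"
proof -
  have "\<exists>S\<subseteq>T. (\<forall>c\<in>S. \<forall>c'\<in>S. c \<noteq> c' \<longrightarrow> \<rho> \<le> infnorm (c - c')) \<and>
     (\<forall>c\<in>T. 0 < \<rho> \<longrightarrow> (\<exists>c'\<in>S. infnorm (c - c') < \<rho>))"
    using assms
  proof (induction T rule: finite_induct)
    case empty
    then show ?case by simp
  next
    case (insert a T)
    then obtain S where S: "S \<subseteq> T" "\<forall>c\<in>S. \<forall>c'\<in>S. c \<noteq> c' \<longrightarrow> \<rho> \<le> infnorm (c - c')"
      "\<forall>c\<in>T. 0 < \<rho> \<longrightarrow> (\<exists>c'\<in>S. infnorm (c - c') < \<rho>)" by blast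
    show ?case
    proof (cases "\<exists>c'\<in>S. infnorm (a - c') < \<rho>")
      case True
      then show ?thesis using S by (intro exI[of _ S]) auto
    next
      case False
      then show ?thesis using S
        by (intro exI[of _ "insert a S"]) (auto simp: not_less infnorm_0 infnorm_sub)
    qed
  qed
  then show ?thesis using that by blast
qed

text \<open>Volume comparison: the cubes of radius \<open>R\<close> around the points are disjoint
  and lie in \<open>cube x (2 * d)\<close>.\<close>

lemma card_separated_in_cube:
  fixes S :: "(real ^ 'n) set"
  assumes S: "finite S" "\<And>c c'. c \<in> S \<Longrightarrow> c' \<in> S \<Longrightarrow> c \<noteq> c' \<Longrightarrow> 4 * R \<le> infnorm (c - c')"
    and R: "0 < R" "R \<le> d" and sub: "S \<subseteq> cube x d"
  shows "real (card S) * R ^ CARD('n) \<le> (2 * d) ^ CARD('n)"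
proof -
  have disj: "disjoint_family_on (\<lambda>c. cube c R) S"
  proof (unfold disjoint_family_on_def, intro ballI impI)
    fix c c' assume c: "c \<in> S" "c' \<in> S" "c \<noteq> c'"
    show "cube c R \<inter> cube c' R = {}"
    proof (rule ccontr)
      assume "cube c R \<inter> cube c' R \<noteq> {}"
      then obtain z where z: "\<And>i. \<bar>z $ i - c $ i\<bar> \<le> R" "\<And>i. \<bar>z $ i - c' $ i\<bar> \<le> R"
        by (auto simp: cube_def)
      have "\<bar>(c - c') $ i\<bar> < 4 * R" for i
        using z[of i] R by (simp; linarith)
      then have "infnorm (c - c') < 4 * R" unfolding infnorm_less_iff_cart by blast
      with S(2)[OF c] show False by simp
    qed
  qed
  have "real (card S) * (2 * R) ^ CARD('n) = (\<Sum>c\<in>S. measure lborel (cube c R))"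
    using R by (simp add: measure_cube)
  also have "\<dots> = measure lborel (\<Union>c\<in>S. cube c R)"
    using S disj fmeasurable_cube
    by (intro measure_finite_Union[symmetric])
       (auto intro: fmeasurableD simp: emeasure_lborel_cube_finite[simplified])
  also have "\<dots> \<le> measure lborel (cube x (2 * d))"
  proof (rule measure_mono_fmeasurable)
    show "(\<Union>c\<in>S. cube c R) \<subseteq> cube x (2 * d)"
    proof safe
      fix c z assume c: "c \<in> S" and z: "z \<in> cube c R"
      have "\<bar>z $ i - x $ i\<bar> \<le> 2 * d" for i
      proof -
        have "\<bar>c $ i - x $ i\<bar> \<le> d" using c sub by (auto simp: cube_def)
        moreover have "\<bar>z $ i - c $ i\<bar> \<le> R" using z by (auto simp: cube_def)
        ultimately show ?thesis using R by linarith
      qed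
      then show "z \<in> cube x (2 * d)" by (simp add: cube_def)
    qed
  qed (use S in \<open>auto intro: fmeasurable_cube\<close>)
  also have "\<dots> = (2 * (2 * d)) ^ CARD('n)" using R by (simp add: measure_cube)
  finally have "2 ^ CARD('n) * (real (card S) * R ^ CARD('n)) \<le> 2 ^ CARD('n) * (2 * d) ^ CARD('n)"
    by (simp only: power_mult_distrib[of 2 R] power_mult_distrib[of 2 "2 * d"] mult.left_commute)
  then show ?thesis by simp
qed

text \<open>
  Here \<open>a\<close> and \<open>b\<close> stand for \<open>\<tau>\<psi>\<close> and \<open>\<tau>\<phi>\<close>. The annulus around \<open>p/q\<close> has outer radius \<open>rad q\<close> and thickness
  \<open>thick q\<close>. For \<open>q \<le> N\<close> the point \<open>center N p q\<close> lies on its face in direction \<open>i0\<close>, at depth \<open>thick N / 2\<close>,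
  so that one and the same small slab around it fits into all these annuli.
\<close>

locale annuli =
  fixes i0 :: "'n::finite" and a b :: real
  assumes a: "1 / real CARD('n) \<le> a" and b: "0 \<le> b"
begin

section \<open>Scales and constants of the construction\<close>

definition rad :: "nat \<Rightarrow> real" where "rad q = real q powr (- 1 - a)"
definition thick :: "nat \<Rightarrow> real" where "thick q = real q powr (- 1 - a - b)"

definition center :: "nat \<Rightarrow> int ^ 'n \<Rightarrow> nat \<Rightarrow> real ^ 'n" where
  "center N p q = (\<chi> i. real_of_int (p $ i) / real q + (if i = i0 then rad q - thick N / 2 else 0))"

text \<open>Chosen so that \<open>kappa * (2 * \<eta>) ^ n = (\<eta> / 2) ^ n / 4\<close>: up to a
  lower-order term, denominators at most \<open>kappa * N\<close> then account for at most a quarter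
  of the volume of a test cube of side \<open>\<eta> / 2\<close>.\<close>

definition kappa :: real where "kappa = 1 / 4 ^ (CARD('n) + 1)"
text \<open>The factor by which \<open>rad\<close> grows when its argument drops from
  \<open>N\<close> to \<open>kappa * N\<close>.\<close>

definition K :: real where "K = kappa powr (- 1 - a)"
text \<open>With \<open>N = m ^ n\<close> this is \<open>K * N powr (- 1 - 1/n)\<close>, so
  \<open>R m ^ n\<close> is the reciprocal of the number of available rational points in a unit
  cube, up to a constant.\<close>

definition R :: "nat \<Rightarrow> real" where "R m = K / (real (m ^ CARD('n)) * real m)"

lemma a_pos: "0 < a"
  using a by (auto intro: less_le_trans[of 0 "1 / real CARD('n)"])

lemma kappa_bounds: "0 < kappa" "kappa \<le> 1"
  using one_le_power[of "4::real" "CARD('n) + 1"] by (auto simp: kappa_def)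

text \<open>The first bound makes \<open>R m\<close> dominate the Dirichlet radius
  \<open>1 / (q * m)\<close> for \<open>q > kappa * N\<close>, the second makes it dominate
  \<open>rad N\<close>.\<close>

lemma K_ge: "1 / kappa \<le> K" "1 \<le> K"
proof -
  have "1 / kappa = (1 / kappa) powr 1" using kappa_bounds by simp
  also have "\<dots> \<le> (1 / kappa) powr (1 + a)"
    using kappa_bounds a_pos by (intro powr_mono) (auto simp: field_simps)
  also have "\<dots> = K"
    using kappa_bounds by (simp add: K_def powr_divide powr_minus_divide[of kappa "1 + a", symmetric] algebra_simps)
  finally show *: "1 / kappa \<le> K" .
  have "1 \<le> 1 / kappa" using kappa_bounds by simp
  with * show "1 \<le> K" by linarith
qed

lemma R_pos: "1 \<le> m \<Longrightarrow> 0 < R m"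
  using K_ge by (simp add: R_def)

lemma rad_pos: "1 \<le> q \<Longrightarrow> 0 < rad q" by (simp add: rad_def)
lemma thick_pos: "1 \<le> q \<Longrightarrow> 0 < thick q" by (simp add: thick_def)

lemma rad_antimono: "1 \<le> q \<Longrightarrow> q \<le> N \<Longrightarrow> rad N \<le> rad q"
  unfolding rad_def using a_pos by (intro powr_mono2') auto

lemma thick_antimono: "1 \<le> q \<Longrightarrow> q \<le> N \<Longrightarrow> thick N \<le> thick q"
  unfolding thick_def using a_pos b by (intro powr_mono2') auto

lemma thick_le_rad: "1 \<le> q \<Longrightarrow> thick q \<le> rad q"
  unfolding thick_def rad_def using b by (intro powr_mono) auto

text \<open>Here \<open>a \<ge> 1/n\<close> enters: for \<open>N = m ^ n\<close> the right-hand side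
  is \<open>N powr (- 1 - 1/n)\<close>.\<close>

lemma rad_le:
  assumes "1 \<le> m"
  shows "rad (m ^ CARD('n)) \<le> 1 / (real (m ^ CARD('n)) * real m)"
proof -
  let ?N = "real (m ^ CARD('n))"
  have N: "1 \<le> ?N" using assms by simp
  have "rad (m ^ CARD('n)) \<le> ?N powr (- 1 - 1 / real CARD('n))"
    unfolding rad_def using a N by (intro powr_mono) auto
  also have "\<dots> = 1 / (?N * ?N powr (1 / real CARD('n)))"
    using N by (simp add: powr_diff powr_minus_divide)
  also have "?N powr (1 / real CARD('n)) = (real m powr real CARD('n)) powr (1 / real CARD('n))"
    using assms by (simp add: powr_realpow)
  also have "\<dots> = real m" using assms by (simp add: powr_powr)
  finally show ?thesis .
qed

lemma rad_le_R:
  assumes m: "1 \<le> m" and q: "kappa * real (m ^ CARD('n)) < real q"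
  shows "rad q \<le> R m"
proof -
  let ?N = "real (m ^ CARD('n))"
  have N: "1 \<le> ?N" using assms by simp
  have "rad q \<le> (kappa * ?N) powr (- 1 - a)"
    unfolding rad_def
  proof (rule powr_mono2')
    show "0 < kappa * ?N" using kappa_bounds m by simp
  qed (use q a_pos in auto)
  also have "\<dots> = K * rad (m ^ CARD('n))"
    unfolding K_def rad_def using kappa_bounds N by (simp add: powr_mult)
  also have "\<dots> \<le> K * (1 / (?N * real m))"
    using rad_le[OF m] K_ge by (intro mult_left_mono) auto
  finally show ?thesis by (simp add: R_def)
qed

lemma R_ge_rad:
  assumes m: "1 \<le> m"
  shows "rad (m ^ CARD('n)) \<le> R m"
proof -
  have "1 / (real (m ^ CARD('n)) * real m) \<le> R m"
    unfolding R_def using K_ge m by (intro divide_right_mono) auto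
  with rad_le[OF m] show ?thesis by linarith
qed

lemma eventually_const_over_le:
  assumes "0 < \<epsilon>" shows "eventually (\<lambda>m. (k::real) / real m \<le> \<epsilon>) sequentially"
proof -
  have "eventually (\<lambda>m. k / real m < \<epsilon>) sequentially"
    by (rule order_tendstoD(2)[OF lim_const_over_n assms])
  then show ?thesis by (rule eventually_mono) simp
qed

lemma eventually_const_over_power_le:
  assumes "0 < \<epsilon>" "0 \<le> k"
  shows "eventually (\<lambda>m. k / real (m ^ CARD('n)) \<le> \<epsilon>) sequentially"
  using eventually_const_over_le[OF assms(1), of k] eventually_ge_at_top[of "1::nat"]
proof eventually_elim
  case (elim m)
  have "m ^ 1 \<le> m ^ CARD('n)" using elim by (intro power_increasing) (auto simp: Suc_leI)
  then have "real m \<le> real (m ^ CARD('n))" using of_nat_mono by fastforce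
  then have "k / real (m ^ CARD('n)) \<le> k / real m"
    using elim assms by (intro divide_left_mono) auto
  then show ?case using elim by simp
qed

lemma eventually_R_le:
  assumes "0 < \<epsilon>" shows "eventually (\<lambda>m. R m \<le> \<epsilon>) sequentially"
  using eventually_const_over_le[OF assms, of K] eventually_ge_at_top[of "1::nat"]
proof eventually_elim
  case (elim m)
  have "R m \<le> K / (1 * real m)"
    unfolding R_def using elim K_ge
    by (intro divide_left_mono mult_right_mono) (auto simp del: of_nat_power simp: Suc_leI)
  then show ?case using elim by simp
qed

text \<open>
  By Dirichlet's theorem the balls of radius comparable to \<open>R m\<close> around the centers with denominators
  between \<open>kappa * N\<close> and \<open>N\<close>, where \<open>N = m\<^sup>n\<close>, cover a fixed proportion of every cube. Since \<open>a \<ge> 1/n\<close>,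
  moving \<open>p/q\<close> to its center costs at most \<open>R m\<close>.
\<close>

lemma selection:
  assumes \<eta>: "0 < \<eta>" "\<eta> \<le> 1" and Z: "finite (Z :: (real^'n) set)"
  shows "eventually (\<lambda>m. \<exists>S. finite S \<and>
    (\<forall>c\<in>S. \<exists>p q. kappa * real (m ^ CARD('n)) < real q \<and> q \<le> m ^ CARD('n) \<and> c = center (m ^ CARD('n)) p q) \<and>
    (\<forall>c\<in>S. \<forall>c'\<in>S. c \<noteq> c' \<longrightarrow> 4 * R m \<le> infnorm (c - c')) \<and>
    (\<forall>y\<in>Z. \<eta> ^ CARD('n) \<le> 2 * 24 ^ CARD('n) * (real (card (S \<inter> cube y (3 / 8 * \<eta>))) * R m ^ CARD('n)))) sequentially"
proof -
  let ?n = "CARD('n)"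
  have "bounded Z" using Z by (rule finite_imp_bounded)
  then obtain b0 where b0: "\<And>y. y \<in> Z \<Longrightarrow> norm y \<le> b0" by (auto simp: bounded_iff)
  have "eventually (\<lambda>m. 7 ^ ?n * (6 / \<eta>) / real (m ^ ?n) \<le> (\<eta> / 2) ^ ?n / 4) sequentially"
    using \<eta> by (intro eventually_const_over_power_le) auto
  moreover have "eventually (\<lambda>m. R m \<le> \<eta> / 48) sequentially"
    using \<eta> by (intro eventually_R_le) auto
  ultimately show ?thesis using eventually_ge_at_top[of "1::nat"]
  proof eventually_elim
    case (elim m)
    define N where "N = m ^ ?n"
    have N: "1 \<le> N" using elim by (simp add: N_def)
    have Rpos: "0 < R m" using elim R_pos by simp
    \<comment> \<open>The cutoff \<open>L\<close> makes \<open>T\<close> finite. Rational points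
      close to a point near \<open>Z\<close> have coordinates of size at most \<open>b0 + 2\<close>,
      so none of interest is lost.\<close>
    define L where "L = \<lceil>real N * (b0 + 2)\<rceil>"
    define T where "T = (\<lambda>(p, q). center N p q) `
      ({p. \<forall>i. p $ i \<in> {- L..L}} \<times> {q. kappa * real N < real q \<and> q \<le> N})"
    have "finite {p :: int^'n. \<forall>i. p $ i \<in> {- L..L}}"
      by (rule finite_card_vec_components_in) simp
    moreover have "finite {q. kappa * real N < real q \<and> q \<le> N}" by simp
    ultimately have "finite T" by (simp add: T_def)
    from maximal_separated_subset[OF this, of "4 * R m"]
    obtain S where S: "S \<subseteq> T" "\<And>c c'. c \<in> S \<Longrightarrow> c' \<in> S \<Longrightarrow> c \<noteq> c' \<Longrightarrow> 4 * R m \<le> infnorm (c - c')"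
      "\<And>c. c \<in> T \<Longrightarrow> \<exists>c'\<in>S. infnorm (c - c') < 4 * R m"
      using Rpos by (metis mult_pos_pos zero_less_numeral)
    have finS: "finite S" using S(1) \<open>finite T\<close> finite_subset by blast
    have main: "\<eta> ^ ?n \<le> 2 * 24 ^ ?n * (real (card (S \<inter> cube y (3 / 8 * \<eta>))) * R m ^ ?n)"
      if y: "y \<in> Z" for y
    proof -
      define M where "M = nat \<lfloor>kappa * real N\<rfloor>"
      obtain B where B: "B \<in> fmeasurable lborel"
        and Bm: "measure lborel B \<le> (real M * (2 * \<eta>) ^ ?n + 7 ^ ?n * (6 / \<eta>)) / real (m ^ ?n)"
        and BI: "\<And>x p q. x \<in> cube y (\<eta> / 4) \<Longrightarrow> 1 \<le> q \<Longrightarrow> q \<le> M \<Longrightarrow>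
           x \<in> cube (rational_point p q) (1 / (real q * real m)) \<Longrightarrow> x \<in> B"
        using measure_small_denominators[OF \<eta> \<open>1 \<le> m\<close>, of M y] by metis
      define Sy where "Sy = S \<inter> cube y (3 / 8 * \<eta>)"
      have finSy: "finite Sy" using finS by (simp add: Sy_def)
      \<comment> \<open>A point is near a rational point of small denominator, hence in
        \<open>B\<close>, or within \<open>2 * R m\<close> of a center, and some selected point is
        less than \<open>4 * R m\<close> from that center. As
        \<open>6 * R m \<le> \<eta> / 8\<close>, the selected point stays within
        \<open>3 / 8 * \<eta>\<close> of \<open>y\<close>.\<close>
      have cover: "cube y (\<eta> / 4) \<subseteq> B \<union> (\<Union>c\<in>Sy. cube c (6 * R m))"
      proof
        fix x assume x: "x \<in> cube y (\<eta> / 4)"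
        obtain q p where q: "1 \<le> q" "q \<le> m ^ ?n"
          and xp: "x \<in> cube (rational_point p q) (1 / (real q * real m))"
          using dirichlet_rational_point[OF \<open>1 \<le> m\<close>, of x] by metis
        show "x \<in> B \<union> (\<Union>c\<in>Sy. cube c (6 * R m))"
        proof (cases "q \<le> M")
          case True
          then show ?thesis using BI[OF x q(1) True xp] by simp
        next
          case False
          then have qk: "kappa * real N < real q"
            unfolding M_def using kappa_bounds by linarith
          have xpi: "\<bar>x $ i - real_of_int (p $ i) / real q\<bar> \<le> 1 / (real q * real m)" for i
            using xp by (simp add: cube_def rational_point_def)
          have near: "1 / (real q * real m) \<le> R m"
          proof -
            have "1 / (real q * real m) \<le> 1 / (kappa * real N * real m)"
              using qk kappa_bounds N elim q by (intro divide_left_mono mult_right_mono) auto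
            also have "\<dots> = (1 / kappa) / (real N * real m)" by simp
            also have "\<dots> \<le> R m" unfolding R_def N_def[symmetric] using K_ge
              by (intro divide_right_mono) auto
            finally show ?thesis .
          qed
          define c where "c = center N p q"
          have rq: "0 \<le> rad q - thick N / 2" "rad q - thick N / 2 \<le> R m"
          proof -
            have "thick N \<le> rad q"
              using thick_antimono[OF q(1)] thick_le_rad[OF q(1)] q by (force simp: N_def)
            then show "0 \<le> rad q - thick N / 2" using thick_pos[OF N] by simp
            show "rad q - thick N / 2 \<le> R m"
              using rad_le_R[OF \<open>1 \<le> m\<close>, of q] qk thick_pos[OF N] by (simp add: N_def)
          qed
          have xc: "\<bar>x $ i - c $ i\<bar> \<le> 2 * R m" for i
            using xpi[of i] near rq Rpos by (auto simp: c_def center_def)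
          have "c \<in> T"
          proof -
            have "p $ i \<in> {- L..L}" for i
            proof -
              have "\<bar>y $ i\<bar> \<le> b0" using b0[OF y] component_le_norm_cart[of y i] by linarith
              moreover have "\<bar>x $ i - y $ i\<bar> \<le> \<eta> / 4" using x by (simp add: cube_def)
              ultimately have "\<bar>real_of_int (p $ i) / real q\<bar> \<le> b0 + 2"
                using xpi[of i] near elim \<eta> by linarith
              then have "\<bar>real_of_int (p $ i)\<bar> \<le> (b0 + 2) * real q"
                using q by (simp add: abs_divide divide_le_eq)
              also have "\<dots> \<le> (b0 + 2) * real N"
              proof (rule mult_left_mono)
                show "0 \<le> b0 + 2" using b0[OF y] norm_ge_zero[of y] by linarith
              qed (use q in \<open>simp add: N_def del: of_nat_power\<close>)
              finally have "\<bar>real_of_int (p $ i)\<bar> \<le> real_of_int L"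
                unfolding L_def by (simp add: mult.commute) linarith
              then have "\<bar>p $ i\<bar> \<le> L" unfolding of_int_abs[symmetric] of_int_le_iff .
              then show ?thesis by auto
            qed
            then show ?thesis using qk q unfolding T_def c_def N_def
              by (intro image_eqI[of _ _ "(p, q)"]) auto
          qed
          then obtain c' where c': "c' \<in> S" "infnorm (c - c') < 4 * R m" using S(3) by blast
          have cc': "\<bar>c $ i - c' $ i\<bar> \<le> 4 * R m" for i
            using c'(2) unfolding infnorm_less_iff_cart by (simp add: less_imp_le)
          have xc': "\<bar>x $ i - c' $ i\<bar> \<le> 6 * R m" for i using xc[of i] cc'[of i] by linarith
          have "\<bar>c' $ i - y $ i\<bar> \<le> 3 / 8 * \<eta>" for i
          proof -
            have "\<bar>x $ i - y $ i\<bar> \<le> \<eta> / 4" using x by (simp add: cube_def)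
            then show ?thesis using xc'[of i] elim by linarith
          qed
          then have "c' \<in> Sy" using c' by (simp add: Sy_def cube_def)
          moreover have "x \<in> cube c' (6 * R m)" using xc' by (simp add: cube_def)
          ultimately show ?thesis by blast
        qed
      qed
      have fmU: "(\<Union>c\<in>Sy. cube c (6 * R m)) \<in> fmeasurable lborel"
        using finSy by (intro fmeasurable.finite_UN) (auto intro: fmeasurable_cube)
      have "(\<eta> / 2) ^ ?n = measure lborel (cube y (\<eta> / 4))"
        using \<eta> by (simp add: measure_cube)
      also have "\<dots> \<le> measure lborel (B \<union> (\<Union>c\<in>Sy. cube c (6 * R m)))"
        using cover B fmU by (intro measure_mono_fmeasurable) auto
      also have "\<dots> \<le> measure lborel B + measure lborel (\<Union>c\<in>Sy. cube c (6 * R m))"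
        using B fmU by (intro measure_Un_le fmeasurableD)
      \<comment> \<open>\<open>B\<close> takes at most half of the volume: a quarter by the choice
        of \<open>kappa\<close>, a quarter because \<open>m\<close> is large. The selected cubes
        must cover the rest; rescaling by \<open>2 ^ n\<close> turns their side
        \<open>12 * R m\<close> into \<open>24 * R m\<close>.\<close>
      also have "\<dots> \<le> (\<eta> / 2) ^ ?n / 2 + real (card Sy) * (12 * R m) ^ ?n"
      proof (rule add_mono)
        have "real M * (2 * \<eta>) ^ ?n \<le> kappa * real N * (2 * \<eta>) ^ ?n"
          using kappa_bounds \<eta> by (intro mult_right_mono) (auto simp: M_def)
        also have "\<dots> = real N * ((\<eta> / 2) ^ ?n / 4)"
        proof -
          have "(2 * \<eta>) ^ ?n = 4 ^ ?n * (\<eta> / 2) ^ ?n"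
            unfolding power_mult_distrib[symmetric] by simp
          then show ?thesis by (simp add: kappa_def)
        qed
        finally have "real M * (2 * \<eta>) ^ ?n / real N \<le> (\<eta> / 2) ^ ?n / 4"
          using N by (simp add: divide_le_eq mult.commute)
        then show "measure lborel B \<le> (\<eta> / 2) ^ ?n / 2"
          using Bm elim unfolding add_divide_distrib N_def[symmetric] by linarith
        have "measure lborel (\<Union>c\<in>Sy. cube c (6 * R m)) \<le> (\<Sum>c\<in>Sy. measure lborel (cube c (6 * R m)))"
          using finSy by (intro measure_UNION_le) auto
        then show "measure lborel (\<Union>c\<in>Sy. cube c (6 * R m)) \<le> real (card Sy) * (12 * R m) ^ ?n"
          using Rpos by (simp add: measure_cube)
      qed
      finally have "(\<eta> / 2) ^ ?n \<le> 2 * (real (card Sy) * (12 * R m) ^ ?n)" by simp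
      then have "2 ^ ?n * (\<eta> / 2) ^ ?n \<le> 2 ^ ?n * (2 * (real (card Sy) * (12 * R m) ^ ?n))"
        by (intro mult_left_mono) auto
      also have "2 ^ ?n * (\<eta> / 2) ^ ?n = \<eta> ^ ?n"
        unfolding power_mult_distrib[symmetric] by simp
      also have "2 ^ ?n * (2 * (real (card Sy) * (12 * R m) ^ ?n)) = 2 * (real (card Sy) * ((2 * 12) ^ ?n * R m ^ ?n))"
        by (simp only: power_mult_distrib mult_ac)
      finally show ?thesis by (simp add: Sy_def mult_ac)
    qed
    show ?case
    proof (intro exI[of _ S] conjI finS)
      show "\<forall>c\<in>S. \<exists>p q. kappa * real (m ^ ?n) < real q \<and> q \<le> m ^ ?n \<and> c = center (m ^ ?n) p q"
        using S(1) by (fastforce simp: T_def N_def)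
    qed (use S(2) main in auto)
  qed
qed

end

section \<open>Slabs and cells\<close>

text \<open>Lets a truncated ratio count with any exponent up to \<open>k\<close>: below 1 smaller
  exponents give larger powers, above 1 the right side is at least 1.\<close>

lemma min_one_power_le_powr:
  fixes x \<sigma> :: real
  assumes "0 < x" "0 \<le> \<sigma>" "\<sigma> \<le> real k"
  shows "min 1 x ^ k \<le> x powr \<sigma>"
proof (cases "x \<le> 1")
  case True
  have "x ^ k = x powr real k" using assms by (simp add: powr_realpow)
  also have "\<dots> \<le> x powr \<sigma>" using assms True by (intro powr_mono') auto
  finally show ?thesis using True by simp
next
  case False
  then show ?thesis using assms by (simp add: ge_one_powr_ge_zero)
qed

text \<open>
  \<open>A\<close> is the mass of a slab with one side \<open>\<delta>\<close> and \<open>k\<close> sides \<open>r\<close>. The two hypotheses on \<open>A\<close> compare it with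
  the two natural covers of the slab, by one cube of side \<open>r\<close> and by cubes of side \<open>\<delta>\<close>.
\<close>

lemma slab_mass_le:
  fixes A \<delta> r s t :: real
  assumes "0 < \<delta>" "0 < r" "0 < t" "0 \<le> A" "0 \<le> s" "s \<le> real (Suc k)"
    and A1: "A \<le> r powr s" and A2: "A \<le> r ^ k * \<delta> powr (s - real k)"
  shows "A * (min 1 (t / \<delta>) * min 1 (t / r) ^ k) \<le> t powr s"
\<comment> \<open>For \<open>s \<le> k\<close> the long sides supply the whole exponent and the thin
  side is bounded by 1. Otherwise the long sides give \<open>t ^ k\<close>, and the thin side has to
  supply only the remaining \<open>\<sigma> \<le> 1\<close>.\<close>
proof (cases "s \<le> real k")
  case True
  have "A * (min 1 (t / \<delta>) * min 1 (t / r) ^ k) \<le> r powr s * (1 * (t / r) powr s)"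
    using assms True by (intro mult_mono A1 min_one_power_le_powr) auto
  also have "\<dots> = t powr s" using assms by (simp add: powr_divide)
  finally show ?thesis .
next
  case False
  define \<sigma> where "\<sigma> = s - real k"
  have s: "0 \<le> \<sigma>" "\<sigma> \<le> 1" using False assms by (auto simp: \<sigma>_def)
  have "A * (min 1 (t / \<delta>) * min 1 (t / r) ^ k) \<le> (r ^ k * \<delta> powr \<sigma>) * ((t / \<delta>) powr \<sigma> * (t / r) ^ k)"
  proof (intro mult_mono)
    show "A \<le> r ^ k * \<delta> powr \<sigma>" using A2 by (simp add: \<sigma>_def)
    show "min 1 (t / \<delta>) \<le> (t / \<delta>) powr \<sigma>"
      using min_one_power_le_powr[of "t / \<delta>" \<sigma> 1] s assms by simp
    show "min 1 (t / r) ^ k \<le> (t / r) ^ k" using assms by (intro power_mono) auto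
  qed (use assms in auto)
  also have "\<dots> = t ^ k * t powr \<sigma>"
    using assms by (simp add: powr_divide power_divide)
  also have "\<dots> = t powr s"
    using assms by (simp add: \<sigma>_def powr_diff powr_realpow)
  finally show ?thesis .
qed

context annuli
begin

definition "hdim = min ((real CARD('n) + 1) / (1 + a))
   ((real CARD('n) + 1 + (real CARD('n) - 1) * b) / (1 + a + b))"

text \<open>Half side lengths. In direction \<open>i0\<close> a slab at depth
  \<open>thick N / 2\<close> thus keeps distance \<open>thick N / 4\<close> from the outer face and
  at least as much from the inner one.\<close>

definition side :: "nat \<Rightarrow> 'n \<Rightarrow> real" where
  "side N i = (if i = i0 then thick N / 4 else rad N / 2)"

definition slab :: "nat \<Rightarrow> real ^ 'n \<Rightarrow> (real ^ 'n) set" where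
  "slab N c = {y. \<forall>i. \<bar>y $ i - c $ i\<bar> \<le> side N i}"

text \<open>The intersection of all \<open>V Q\<close> is the limsup set of the annuli. Openness of
  \<open>V Q\<close> is what allows compact neighbourhoods of the supports to be kept inside it;
  \<open>max 1 Q\<close> excludes the denominator 0.\<close>

definition V :: "nat \<Rightarrow> (real ^ 'n) set" where
  "V Q = (\<Union>q\<in>{max 1 Q..}. \<Union>p. annulus (rational_point p q) ((1 - real q powr (- b)) * rad q) (rad q))"

lemma card_ge_1: "1 \<le> CARD('n)" by (simp add: Suc_leI)

lemma hdim_pos: "0 < hdim"
proof -
  have "0 \<le> (real CARD('n) - 1) * b" using b card_ge_1 by (intro mult_nonneg_nonneg) auto
  then have "0 < real CARD('n) + 1 + (real CARD('n) - 1) * b" by simp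
  then show ?thesis using a_pos b unfolding hdim_def by (simp add: divide_pos_pos)
qed

text \<open>Because \<open>n * a \<ge> 1\<close>. Hence \<open>s < hdim\<close> also leaves a spare
  exponent \<open>n - s\<close>, used at the intermediate scales, where slabs are merely
  counted.\<close>

lemma hdim_le_card: "hdim \<le> real CARD('n)"
proof -
  have "1 \<le> real CARD('n) * a" using a by (simp add: divide_le_eq mult.commute)
  then have "(real CARD('n) + 1) / (1 + a) \<le> real CARD('n)"
    using a_pos by (simp add: divide_le_eq algebra_simps)
  then show ?thesis by (simp add: hdim_def)
qed

lemma open_annulus: "open (annulus c u v :: (real^'n) set)"
  unfolding annulus_def by (intro open_Collect_conj open_Collect_less continuous_intros)

lemma open_V: "open (V Q)"
  unfolding V_def by (intro open_UN ballI open_annulus)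

lemma slab_eq_cbox: "slab N c = cbox (\<chi> i. c $ i - side N i) (\<chi> i. c $ i + side N i)"
  by (auto simp: slab_def mem_box_cart abs_le_iff algebra_simps)

lemma side_pos: "1 \<le> N \<Longrightarrow> 0 < side N i"
  using rad_pos thick_pos by (simp add: side_def)

lemma side_le: "1 \<le> N \<Longrightarrow> side N i \<le> rad N"
  using rad_pos[of N] thick_pos[of N] thick_le_rad[of N] by (simp add: side_def)

lemma slab_subset_cube:
  assumes "1 \<le> N" "rad N \<le> \<rho>" shows "slab N c \<subseteq> cube c \<rho>"
proof
  fix y assume "y \<in> slab N c"
  then have "\<bar>y $ i - c $ i\<bar> \<le> \<rho>" for i
    using side_le[OF assms(1), of i] assms(2) unfolding slab_def by (auto dest!: spec[of _ i])
  then show "y \<in> cube c \<rho>" by (simp add: cube_def)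
qed

lemma prod_if_i0: "(\<Prod>i\<in>UNIV. if i = i0 then u else v) = (u::real) * v ^ (CARD('n) - 1)"
proof -
  have "(\<Prod>i\<in>UNIV. if i = i0 then u else v) = u * (\<Prod>i\<in>UNIV - {i0}. if i = i0 then u else v)"
    by (subst prod.remove[of _ i0]) auto
  also have "(\<Prod>i\<in>UNIV - {i0}. if i = i0 then u else v) = (\<Prod>i\<in>UNIV - {i0}. v)"
    by (intro prod.cong) auto
  finally show ?thesis by (simp add: card_Diff_singleton)
qed

lemma measure_slab:
  assumes "1 \<le> N"
  shows "measure lborel (slab N c) = thick N / 2 * rad N ^ (CARD('n) - 1)"
proof -
  have "c \<in> slab N c" using side_pos[OF assms] by (simp add: slab_def less_imp_le)
  then have "measure lborel (slab N c) = (\<Prod>i\<in>UNIV. 2 * side N i)"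
    unfolding slab_eq_cbox by (subst content_cbox_cart) auto
  also have "\<dots> = (\<Prod>i\<in>UNIV. if i = i0 then thick N / 2 else rad N)"
    by (intro prod.cong) (auto simp: side_def)
  finally show ?thesis by (simp add: prod_if_i0)
qed

lemma measure_slab_Int_cube:
  assumes N: "1 \<le> N" and d: "0 < d"
  shows "measure lborel (slab N c \<inter> cube x d) \<le> min (thick N / 2) (2 * d) * min (rad N) (2 * d) ^ (CARD('n) - 1)"
proof -
  \<comment> \<open>In each coordinate the shorter of the two intervals is kept; \<open>z\<close> is
    the center of the resulting box and \<open>h\<close> its half sides.\<close>
  define z where "z = (\<chi> i. if side N i \<le> d then c $ i else x $ i)"
  define h where "h = (\<lambda>i. min (side N i) d)"
  define B where "B = cbox (\<chi> i. z $ i - h i) (\<chi> i. z $ i + h i)"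
  have "z \<in> B" using side_pos[OF N] d by (auto simp: B_def mem_box_cart h_def less_imp_le)
  then have mB: "measure lborel B = (\<Prod>i\<in>UNIV. 2 * h i)"
    unfolding B_def by (subst content_cbox_cart) auto
  have "slab N c \<inter> cube x d \<subseteq> B"
  proof
    fix y assume y: "y \<in> slab N c \<inter> cube x d"
    have "\<bar>y $ i - z $ i\<bar> \<le> h i" for i
    proof -
      have "\<bar>y $ i - c $ i\<bar> \<le> side N i" "\<bar>y $ i - x $ i\<bar> \<le> d"
        using y unfolding slab_def cube_def by blast+
      then show ?thesis by (cases "side N i \<le> d") (simp_all add: z_def h_def)
    qed
    then show "y \<in> B" by (auto simp: B_def mem_box_cart abs_le_iff algebra_simps)
  qed
  then have "measure lborel (slab N c \<inter> cube x d) \<le> measure lborel B"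
    by (intro measure_mono_fmeasurable) (auto simp: B_def slab_eq_cbox)
  also have "\<dots> = (\<Prod>i\<in>UNIV. if i = i0 then min (thick N / 2) (2 * d) else min (rad N) (2 * d))"
    unfolding mB by (intro prod.cong) (auto simp: h_def side_def min_def)
  finally show ?thesis by (simp add: prod_if_i0)
qed

text \<open>The growth bound for a uniform mass \<open>1 / N ^ (n + 1)\<close> on one slab.
  \<open>d1\<close> and \<open>d2\<close>, one for each term of the minimum, are exactly what the
  two hypotheses of \<open>slab_mass_le\<close> require. The 4 comes from a cube of side
  \<open>2 * d\<close> meeting a slab of thickness \<open>thick N / 2\<close>.\<close>

lemma slab_ratio_le:
  assumes N: "1 \<le> N" and d: "0 < d"
  shows "1 / real N ^ (CARD('n) + 1) * (measure lborel (slab N c \<inter> cube x d) / measure lborel (slab N c))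
     \<le> (4 * d) powr hdim"
proof -
  let ?k = "CARD('n) - 1"
  have pos: "0 < thick N" "0 < rad N" using N thick_pos rad_pos by auto
  have k: "real ?k = real CARD('n) - 1" "Suc ?k = CARD('n)" using card_ge_1 by auto
  have NN: "1 / real N ^ (CARD('n) + 1) = real N powr (- (real CARD('n) + 1))"
  proof -
    have "real N powr real (CARD('n) + 1) = real N ^ (CARD('n) + 1)"
      by (rule powr_realpow) (use N in simp)
    then show ?thesis unfolding powr_minus_divide by (simp only: of_nat_add of_nat_1)
  qed
  have d1: "(1 + a) * hdim \<le> real CARD('n) + 1"
  proof -
    have "hdim \<le> (real CARD('n) + 1) / (1 + a)" by (simp add: hdim_def)
    then show ?thesis using a_pos by (simp add: le_divide_eq mult.commute)
  qed
  have d2: "(1 + a + b) * hdim \<le> real CARD('n) + 1 + (real CARD('n) - 1) * b"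
  proof -
    have "hdim \<le> (real CARD('n) + 1 + (real CARD('n) - 1) * b) / (1 + a + b)" by (simp add: hdim_def)
    then show ?thesis using a_pos b by (simp add: le_divide_eq mult.commute)
  qed
  have "measure lborel (slab N c \<inter> cube x d) / measure lborel (slab N c)
     \<le> min (thick N / 2) (2 * d) * min (rad N) (2 * d) ^ ?k / (thick N / 2 * rad N ^ ?k)"
    unfolding measure_slab[OF N] using pos by (intro divide_right_mono measure_slab_Int_cube N d) auto
  also have "\<dots> = min (thick N / 2) (2 * d) / (thick N / 2) * (min (rad N) (2 * d) / rad N) ^ ?k"
    by (simp add: power_divide)
  also have "\<dots> \<le> min 1 (4 * d / thick N) * min 1 (4 * d / rad N) ^ ?k"
  proof (intro mult_mono power_mono)
    show "min (thick N / 2) (2 * d) / (thick N / 2) \<le> min 1 (4 * d / thick N)"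
      using pos by (auto simp: min_def field_simps)
    show "min (rad N) (2 * d) / rad N \<le> min 1 (4 * d / rad N)"
      using pos d by (auto simp: min_def field_simps)
  qed (use pos d in auto)
  finally have "1 / real N ^ (CARD('n) + 1) * (measure lborel (slab N c \<inter> cube x d) / measure lborel (slab N c))
    \<le> 1 / real N ^ (CARD('n) + 1) * (min 1 (4 * d / thick N) * min 1 (4 * d / rad N) ^ ?k)"
    by (intro mult_left_mono) auto
  also have "\<dots> \<le> (4 * d) powr hdim"
  proof (rule slab_mass_le)
    show "1 / real N ^ (CARD('n) + 1) \<le> rad N powr hdim"
      unfolding NN rad_def powr_powr using N d1 by (intro powr_mono) (auto simp: algebra_simps)
    have "rad N ^ ?k * thick N powr (hdim - real ?k)
      = real N powr ((- 1 - a) * real ?k + (- 1 - a - b) * (hdim - real ?k))"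
      unfolding rad_def thick_def powr_powr using N
      by (simp add: powr_realpow[symmetric] powr_powr powr_add)
    also have "real N powr (- (real CARD('n) + 1)) \<le> \<dots>"
      unfolding k using N d2 by (intro powr_mono) (auto simp: algebra_simps)
    finally show "1 / real N ^ (CARD('n) + 1) \<le> rad N ^ ?k * thick N powr (hdim - real ?k)"
      unfolding NN .
    show "hdim \<le> real (Suc ?k)" unfolding k by (rule hdim_le_card)
  qed (use pos d hdim_pos in auto)
  finally show ?thesis .
qed

text \<open>The \<open>i0\<close> coordinate alone exceeds the inner radius
  \<open>rad q - thick q\<close>; all coordinates stay below \<open>rad q\<close>, since
  \<open>thick\<close> and \<open>rad\<close> decrease from \<open>q\<close> to
  \<open>N\<close>.\<close>

lemma slab_subset_annulus:
  assumes q: "1 \<le> q" "q \<le> N"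
  shows "slab N (center N p q) \<subseteq> annulus (rational_point p q) ((1 - real q powr (- b)) * rad q) (rad q)"
proof
  fix y assume y: "y \<in> slab N (center N p q)"
  define u where "u = y - rational_point p q"
  have N: "1 \<le> N" using q by simp
  have pos: "0 < thick N" "0 < rad N" using N thick_pos rad_pos by auto
  have tq: "thick N \<le> thick q" "rad N \<le> rad q" "thick q \<le> rad q"
    using q thick_antimono rad_antimono thick_le_rad by auto
  have "thick q = real q powr (- b) * rad q"
    unfolding thick_def rad_def powr_add[symmetric] by (rule arg_cong2[where f="(powr)"]) simp_all
  then have eq: "(1 - real q powr (- b)) * rad q = rad q - thick q"
    by (simp add: algebra_simps)
  have "\<bar>y $ i0 - center N p q $ i0\<bar> \<le> side N i0" using y unfolding slab_def by blast
  then have u0: "\<bar>u $ i0 - (rad q - thick N / 2)\<bar> \<le> thick N / 4"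
    by (simp add: center_def u_def rational_point_def side_def algebra_simps)
  have u1: "\<bar>u $ i\<bar> \<le> rad N / 2" if "i \<noteq> i0" for i
  proof -
    have "\<bar>y $ i - center N p q $ i\<bar> \<le> side N i" using y unfolding slab_def by blast
    then show ?thesis using that by (simp add: center_def u_def rational_point_def side_def)
  qed
  have "\<bar>u $ i\<bar> < rad q" for i
  proof (cases "i = i0")
    case True
    show ?thesis unfolding True using u0 tq pos by linarith
  next
    case False
    show ?thesis using u1[OF False] tq pos by linarith
  qed
  then have "infnorm u < rad q" by (simp add: infnorm_less_iff_cart)
  moreover have "rad q - thick q < u $ i0" using u0 tq pos by linarith
  then have "rad q - thick q < infnorm u" using component_le_infnorm_cart[of u i0] by linarith
  ultimately show "y \<in> annulus (rational_point p q) ((1 - real q powr (- b)) * rad q) (rad q)"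
    by (simp add: annulus_def eq u_def)
qed

end

section \<open>The grid of half-open cubes\<close>

definition cell_index :: "real \<Rightarrow> real ^ 'n \<Rightarrow> int ^ 'n" where
  "cell_index \<eta> y = (\<chi> i. \<lfloor>y $ i / \<eta>\<rfloor>)"

definition cell :: "real \<Rightarrow> int ^ 'n \<Rightarrow> (real ^ 'n) set" where
  "cell \<eta> z = {y. cell_index \<eta> y = z}"

definition cell_mid :: "real \<Rightarrow> int ^ 'n \<Rightarrow> real ^ 'n" where
  "cell_mid \<eta> z = (\<chi> i. (real_of_int (z $ i) + 1 / 2) * \<eta>)"

lemma mem_cell_iff:
  assumes "0 < \<eta>"
  shows "y \<in> cell \<eta> z \<longleftrightarrow> (\<forall>i. real_of_int (z $ i) * \<eta> \<le> y $ i \<and> y $ i < (real_of_int (z $ i) + 1) * \<eta>)"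
  using assms by (simp add: cell_def cell_index_def vec_eq_iff floor_eq_iff pos_le_divide_eq pos_divide_less_eq)

lemma cell_sets [measurable]:
  assumes "0 < \<eta>" shows "cell \<eta> z \<in> sets borel"
proof -
  have "cell \<eta> z = {y \<in> space borel. \<forall>i. real_of_int (z $ i) * \<eta> \<le> y $ i \<and> y $ i < (real_of_int (z $ i) + 1) * \<eta>}"
    using mem_cell_iff[OF assms] by auto
  also have "\<dots> \<in> sets borel" by measurable
  finally show ?thesis .
qed

lemma cell_subset_cube_mid:
  assumes "0 < \<eta>" shows "cell \<eta> z \<subseteq> cube (cell_mid \<eta> z) (\<eta> / 2)"
proof
  fix y assume "y \<in> cell \<eta> z"
  then have "real_of_int (z $ i) * \<eta> \<le> y $ i \<and> y $ i < (real_of_int (z $ i) + 1) * \<eta>" for i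
    using mem_cell_iff[OF assms] by blast
  then have *: "real_of_int (z $ i) * \<eta> \<le> y $ i" "y $ i < real_of_int (z $ i) * \<eta> + \<eta>" for i
    by (simp_all add: distrib_right)
  have "\<bar>y $ i - (real_of_int (z $ i) * \<eta> + 1 / 2 * \<eta>)\<bar> \<le> \<eta> / 2" for i
    using *[of i] by linarith
  then have "\<bar>y $ i - (real_of_int (z $ i) + 1 / 2) * \<eta>\<bar> \<le> \<eta> / 2" for i
    unfolding distrib_right .
  then show "y \<in> cube (cell_mid \<eta> z) (\<eta> / 2)" by (simp add: cube_def cell_mid_def)
qed

text \<open>\<open>3 / 8 * \<eta>\<close> is the radius in which \<open>selection\<close> counts
  centers, so the centers counted there belong to this cell.\<close>

lemma cube_mid_subset_cell:
  assumes "0 < \<eta>" shows "cube (cell_mid \<eta> z) (3 / 8 * \<eta>) \<subseteq> cell \<eta> z"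
proof
  fix y assume "y \<in> cube (cell_mid \<eta> z) (3 / 8 * \<eta>)"
  then have *: "\<bar>y $ i - (real_of_int (z $ i) + 1 / 2) * \<eta>\<bar> \<le> 3 / 8 * \<eta>" for i
    by (simp add: cube_def cell_mid_def)
  have "real_of_int (z $ i) * \<eta> \<le> y $ i \<and> y $ i < (real_of_int (z $ i) + 1) * \<eta>" for i
    using *[of i] assms unfolding distrib_right abs_le_iff by (auto simp: field_simps)
  then show "y \<in> cell \<eta> z" using mem_cell_iff[OF assms] by blast
qed

lemma cell_subset_cube:
  assumes "0 < \<eta>" "c \<in> cell \<eta> z" shows "cell \<eta> z \<subseteq> cube c \<eta>"
proof
  fix y assume y: "y \<in> cell \<eta> z"
  have "\<bar>y $ i - c $ i\<bar> \<le> \<eta>" for i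
  proof -
    have "\<bar>y $ i - cell_mid \<eta> z $ i\<bar> \<le> \<eta> / 2" "\<bar>c $ i - cell_mid \<eta> z $ i\<bar> \<le> \<eta> / 2"
      using cell_subset_cube_mid[OF assms(1)] y assms(2) unfolding cube_def by blast+
    then show ?thesis by linarith
  qed
  then show "y \<in> cube c \<eta>" by (simp add: cube_def)
qed

lemma finite_cell_index_image:
  assumes "bounded (X :: (real^'n) set)" "0 < \<eta>" shows "finite (cell_index \<eta> ` X)"
proof -
  obtain B where B: "\<And>x. x \<in> X \<Longrightarrow> norm x \<le> B" using assms by (auto simp: bounded_iff)
  have "cell_index \<eta> ` X \<subseteq> {p. \<forall>i. p $ i \<in> {\<lfloor>- B / \<eta>\<rfloor>..\<lfloor>B / \<eta>\<rfloor>}}"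
  proof safe
    fix x i assume "x \<in> X"
    then have "\<bar>x $ i\<bar> \<le> B" using B component_le_norm_cart[of x i] by force
    then have "- B \<le> x $ i" "x $ i \<le> B" by linarith+
    then have "- B / \<eta> \<le> x $ i / \<eta>" "x $ i / \<eta> \<le> B / \<eta>"
      using assms(2) divide_right_mono less_imp_le by blast+
    then have "\<lfloor>- B / \<eta>\<rfloor> \<le> \<lfloor>x $ i / \<eta>\<rfloor>" "\<lfloor>x $ i / \<eta>\<rfloor> \<le> \<lfloor>B / \<eta>\<rfloor>"
      by (blast intro: floor_mono)+
    then show "cell_index \<eta> x $ i \<in> {\<lfloor>- B / \<eta>\<rfloor>..\<lfloor>B / \<eta>\<rfloor>}"
      unfolding cell_index_def by simp
  qed
  moreover have "finite {p :: int^'n. \<forall>i. p $ i \<in> {\<lfloor>- B / \<eta>\<rfloor>..\<lfloor>B / \<eta>\<rfloor>}}"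
    by (rule finite_card_vec_components_in) simp
  ultimately show ?thesis by (rule finite_subset)
qed

section \<open>Redistribution of mass\<close>

text \<open>The strict \<open>M < C\<close> lets the next stage enlarge the growth constant slightly
  while the same \<open>C\<close> serves for all stages. The density bound \<open>F\<close> is only
  required to exist and may change from stage to stage.\<close>

definition frostman :: "real \<Rightarrow> real \<Rightarrow> (real ^ 'n) measure \<Rightarrow> (real ^ 'n) set \<Rightarrow> bool" where
  "frostman s C \<mu> X \<longleftrightarrow> sets \<mu> = sets borel \<and> emeasure \<mu> UNIV = 1 \<and> compact X \<and> measure \<mu> (- X) = 0 \<and>
     (\<exists>F\<ge>0. \<forall>A\<in>fmeasurable lborel. measure \<mu> A \<le> F * measure lborel A) \<and>
     (\<exists>M<C. \<forall>x. \<forall>d>0. measure \<mu> (cube x d) \<le> M * d powr s)"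

text \<open>Every cell shares its mass equally among its points of \<open>S\<close>. A subset
  collects only some of the shares, hence an inequality; \<open>S\<close> collects all of
  them.\<close>

lemma sum_cell_weights:
  fixes \<mu> :: "(real ^ 'n) measure" and S :: "(real ^ 'n) set"
  assumes "finite_measure \<mu>" and sets: "sets \<mu> = sets borel" and \<eta>: "0 < \<eta>" and S: "finite S"
    and w: "\<And>c. w c = measure \<mu> (cell \<eta> (cell_index \<eta> c)) /
        real (card {c'\<in>S. cell_index \<eta> c' = cell_index \<eta> c})"
  shows "X \<subseteq> S \<Longrightarrow> sum w X \<le> measure \<mu> (\<Union>c\<in>X. cell \<eta> (cell_index \<eta> c))"
    and "sum w S = measure \<mu> (\<Union>c\<in>S. cell \<eta> (cell_index \<eta> c))"
proof -
  interpret finite_measure \<mu> by fact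
  have union: "(\<Sum>z\<in>cell_index \<eta> ` Y. measure \<mu> (cell \<eta> z)) = measure \<mu> (\<Union>c\<in>Y. cell \<eta> (cell_index \<eta> c))"
    if "finite Y" for Y
  proof -
    have "(\<Sum>z\<in>cell_index \<eta> ` Y. measure \<mu> (cell \<eta> z)) = measure \<mu> (\<Union>z\<in>cell_index \<eta> ` Y. cell \<eta> z)"
      using that \<eta> by (intro finite_measure_finite_Union[symmetric])
         (auto simp: sets disjoint_family_on_def cell_def cell_sets[unfolded cell_def])
    then show ?thesis by simp
  qed
  have fibre: "sum w {c\<in>Y. cell_index \<eta> c = z}
      = real (card {c\<in>Y. cell_index \<eta> c = z}) * (measure \<mu> (cell \<eta> z) / real (card {c\<in>S. cell_index \<eta> c = z}))"
    for Y z
  proof -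
    have "sum w {c\<in>Y. cell_index \<eta> c = z}
      = (\<Sum>c\<in>{c\<in>Y. cell_index \<eta> c = z}. measure \<mu> (cell \<eta> z) / real (card {c\<in>S. cell_index \<eta> c = z}))"
      by (intro sum.cong) (auto simp: w)
    then show ?thesis by simp
  qed
  show "sum w X \<le> measure \<mu> (\<Union>c\<in>X. cell \<eta> (cell_index \<eta> c))" if X: "X \<subseteq> S"
  proof -
    have fin: "finite X" using X S finite_subset by blast
    have "sum w X = (\<Sum>z\<in>cell_index \<eta> ` X. sum w {c\<in>X. cell_index \<eta> c = z})"
      using fin by (rule sum.image_gen)
    also have "\<dots> \<le> (\<Sum>z\<in>cell_index \<eta> ` X. measure \<mu> (cell \<eta> z))"
    proof (rule sum_mono)
      fix z
      have "card {c\<in>X. cell_index \<eta> c = z} \<le> card {c\<in>S. cell_index \<eta> c = z}"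
        using X S by (intro card_mono) auto
      then show "sum w {c\<in>X. cell_index \<eta> c = z} \<le> measure \<mu> (cell \<eta> z)"
        unfolding fibre
        by (cases "card {c\<in>S. cell_index \<eta> c = z} = 0")
           (auto simp: divide_le_eq mult.commute intro!: mult_left_mono)
    qed
    finally show ?thesis using union[OF fin] by simp
  qed
  have "sum w S = (\<Sum>z\<in>cell_index \<eta> ` S. sum w {c\<in>S. cell_index \<eta> c = z})"
    using S by (rule sum.image_gen)
  also have "\<dots> = (\<Sum>z\<in>cell_index \<eta> ` S. measure \<mu> (cell \<eta> z))"
  proof (rule sum.cong)
    fix z assume "z \<in> cell_index \<eta> ` S"
    then have "card {c\<in>S. cell_index \<eta> c = z} \<noteq> 0" using S by auto
    then show "sum w {c\<in>S. cell_index \<eta> c = z} = measure \<mu> (cell \<eta> z)"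
      unfolding fibre by simp
  qed simp
  finally show "sum w S = measure \<mu> (\<Union>c\<in>S. cell \<eta> (cell_index \<eta> c))" using union[OF S] by simp
qed

lemma ex_small_powr:
  fixes D t \<epsilon> :: real
  assumes "0 < \<epsilon>" "0 \<le> D" "0 < t"
  obtains u0 where "0 < u0" "\<And>u. 0 < u \<Longrightarrow> u \<le> u0 \<Longrightarrow> D * u powr t \<le> \<epsilon>"
proof
  let ?u0 = "(\<epsilon> / (D + 1)) powr (1 / t)"
  show "0 < ?u0" using assms by simp
  fix u :: real assume u: "0 < u" "u \<le> ?u0"
  have "u powr t \<le> ?u0 powr t" using u assms by (intro powr_mono2) auto
  also have "\<dots> = \<epsilon> / (D + 1)" using assms by (simp add: powr_powr)
  finally have "D * u powr t \<le> D * (\<epsilon> / (D + 1))" using assms by (intro mult_left_mono) auto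
  also have "\<dots> \<le> \<epsilon>" using assms by (simp add: field_simps)
  finally show "D * u powr t \<le> \<epsilon>" .
qed

text \<open>For \<open>d \<ge> L * \<eta>\<close>, moving mass by at most \<open>2 * \<eta>\<close>
  enlarges the radius by a factor of at most \<open>1 + 2 / L\<close>, whose effect fits between
  \<open>M\<close> and \<open>M'\<close> for large \<open>L\<close>.\<close>

lemma ex_dilation_factor:
  fixes M M' s :: real
  assumes "M < M'" "0 \<le> M"
  obtains L where "1 \<le> L" "M * (1 + 2 / L) powr s \<le> M'"
proof -
  have "(\<lambda>k. M * (1 + 2 / real k) powr s) \<longlonglongrightarrow> M * (1 + 0) powr s"
    by (intro tendsto_intros lim_const_over_n) auto
  then have "eventually (\<lambda>k. M * (1 + 2 / real k) powr s < M') sequentially"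
    using assms by (intro order_tendstoD) auto
  then have "eventually (\<lambda>k. M * (1 + 2 / real k) powr s < M' \<and> 1 \<le> k) sequentially"
    using eventually_ge_at_top[of "1::nat"] by eventually_elim simp
  then obtain k where "M * (1 + 2 / real k) powr s < M'" "1 \<le> k"
    by (auto simp: eventually_sequentially)
  then show ?thesis by (intro that[of "real k"]) auto
qed

lemma compact_in_open_coordinate_gap:
  fixes X U :: "(real ^ 'n) set"
  assumes "compact X" "open U" "X \<subseteq> U"
  obtains \<rho> where "0 < \<rho>" "\<And>x. x \<in> X \<Longrightarrow> cube x \<rho> \<subseteq> U"
proof -
  obtain e where e: "0 < e" "(\<Union>x\<in>X. cball x e) \<subseteq> U"
    using compact_subset_open_imp_cball_epsilon_subset[OF assms] by blast
  show ?thesis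
  proof (rule that[of "e / real CARD('n)"])
    show "0 < e / real CARD('n)" using e by simp
    fix x assume x: "x \<in> X"
    show "cube x (e / real CARD('n)) \<subseteq> U"
    proof
      fix y assume "y \<in> cube x (e / real CARD('n))"
      then have "dist y x \<le> real CARD('n) * (e / real CARD('n))"
        by (intro dist_le_card_mult) (simp add: cube_def)
      then have "y \<in> cball x e" by (simp add: dist_commute)
      then show "y \<in> U" using e x by blast
    qed
  qed
qed

context annuli
begin

text \<open>Turns a weight of order \<open>R m ^ n\<close> into a constant times the slab mass for
  which \<open>slab_ratio_le\<close> is stated.\<close>

lemma R_power: "1 \<le> m \<Longrightarrow> R m ^ CARD('n) = K ^ CARD('n) * (1 / real (m ^ CARD('n)) ^ (CARD('n) + 1))"
  by (simp add: R_def power_divide power_mult_distrib)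

text \<open>
  The mass of every cell of side \<open>\<eta>\<close> is redistributed uniformly over the selected slabs in it. Balls of
  radius at least \<open>L * \<eta>\<close> hardly notice this. Smaller balls only see the density bound \<open>F\<close> of the old measure,
  and since the slabs satisfy the growth bound with the larger exponent \<open>hdim\<close>, there is a spare factor
  \<open>(L * \<eta>) powr (hdim - s)\<close>, which for small \<open>\<eta>\<close> beats every constant.
\<close>

lemma frostman_refine:
  assumes s: "0 \<le> s" "s < hdim" and C: "0 < C" and fr: "frostman s C \<mu> X"
    and U: "open U" "X \<subseteq> U"
  shows "\<exists>\<mu>' X'. frostman s C \<mu>' X' \<and> X' \<subseteq> U \<inter> V Q"
proof -
  let ?n = "CARD('n)"
  have sets: "sets \<mu> = sets borel" and tot: "emeasure \<mu> UNIV = 1" and X: "compact X" and X0: "measure \<mu> (- X) = 0"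
    using fr by (auto simp: frostman_def)
  obtain F where F: "0 \<le> F" "\<And>A. A \<in> fmeasurable lborel \<Longrightarrow> measure \<mu> A \<le> F * measure lborel A"
    using fr by (auto simp: frostman_def)
  obtain M0 where M0: "M0 < C" "\<And>x d. 0 < d \<Longrightarrow> measure \<mu> (cube x d) \<le> M0 * d powr s"
    using fr by (auto simp: frostman_def)
  define M where "M = max M0 0"
  have M: "0 \<le> M" "M < C" "\<And>x d. 0 < d \<Longrightarrow> measure \<mu> (cube x d) \<le> M * d powr s"
  proof -
    fix x and d :: real assume "0 < d"
    then show "measure \<mu> (cube x d) \<le> M * d powr s"
      by (intro order_trans[OF M0(2)] mult_right_mono) (auto simp: M_def)
  qed (use M0 C in \<open>auto simp: M_def\<close>)
  define M' where "M' = (M + C) / 2"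
  have M': "M < M'" "M' < C" "0 < M'" using M C by (auto simp: M'_def)
  have space: "space \<mu> = UNIV" using sets_eq_imp_space_eq[OF sets] by simp
  interpret finite_measure \<mu> using tot space by (intro finite_measureI) auto
  have tot': "measure \<mu> UNIV = 1" using tot by (simp add: measure_def)
  obtain \<rho> where \<rho>: "0 < \<rho>" "\<And>x. x \<in> X \<Longrightarrow> cube x \<rho> \<subseteq> U"
    using compact_in_open_coordinate_gap[OF X U] by metis
  obtain L where L: "1 \<le> L" "M * (1 + 2 / L) powr s \<le> M'"
    using ex_dilation_factor[OF M'(1) M(1)] by metis
  \<comment> \<open>The counting constant of \<open>selection\<close> times the density bound; no
    selected slab will get more than \<open>D * r ^ n\<close>.\<close>
  define D where "D = 2 * 24 ^ ?n * F"
  have D: "0 \<le> D" using F by (simp add: D_def)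
  have sn: "s < real ?n" using s hdim_le_card by linarith
  obtain u1 where u1: "0 < u1" "\<And>u. 0 < u \<Longrightarrow> u \<le> u1 \<Longrightarrow> (D * 4 ^ ?n) * u powr (real ?n - s) \<le> M'"
    using ex_small_powr[of M' "D * 4 ^ ?n" "real ?n - s"] M' D sn by auto
  obtain u2 where u2: "0 < u2" "\<And>u. 0 < u \<Longrightarrow> u \<le> u2 \<Longrightarrow> (D * K ^ ?n * 4 powr hdim) * u powr (hdim - s) \<le> M'"
    using ex_small_powr[of M' "D * K ^ ?n * 4 powr hdim" "hdim - s"] M' D s K_ge by auto
  \<comment> \<open>\<open>\<rho> / 2\<close> keeps the new slabs inside \<open>U\<close>.
    \<open>u1 / L\<close> and \<open>u2 / L\<close> make the spare powers \<open>n - s\<close> and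
    \<open>hdim - s\<close> beat the constants at all radii below \<open>L * \<eta>\<close>.\<close>
  define \<eta> where "\<eta> = Min {1, \<rho> / 2, u1 / L, u2 / L}"
  have \<eta>: "0 < \<eta>" "\<eta> \<le> 1" "2 * \<eta> \<le> \<rho>" "L * \<eta> \<le> u1" "L * \<eta> \<le> u2"
  proof -
    show "0 < \<eta>" unfolding \<eta>_def using \<rho> u1 u2 L by simp
    have "\<eta> \<le> 1" "\<eta> \<le> \<rho> / 2" "\<eta> \<le> u1 / L" "\<eta> \<le> u2 / L" unfolding \<eta>_def by (intro Min_le; simp)+
    then show "\<eta> \<le> 1" "2 * \<eta> \<le> \<rho>" "L * \<eta> \<le> u1" "L * \<eta> \<le> u2"
      using L by (simp_all add: le_divide_eq mult.commute)
  qed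
  define Z where "Z = cell_index \<eta> ` X"
  have finZ: "finite (cell_mid \<eta> ` Z)"
    unfolding Z_def using compact_imp_bounded[OF X] \<eta> by (intro finite_imageI finite_cell_index_image)
  \<comment> \<open>Ensures \<open>Q \<le> kappa * N\<close>, so that all selected denominators
    exceed \<open>Q\<close>.\<close>
  have "eventually (\<lambda>m. real Q / kappa / real (m ^ ?n) \<le> 1) sequentially"
    using kappa_bounds by (intro eventually_const_over_power_le) auto
  with selection[OF \<eta>(1,2) finZ] eventually_R_le[OF \<eta>(1)] eventually_ge_at_top[of "1::nat"]
  have "eventually (\<lambda>m. \<exists>S. finite S \<and>
    (\<forall>c\<in>S. \<exists>p q. kappa * real (m ^ ?n) < real q \<and> q \<le> m ^ ?n \<and> c = center (m ^ ?n) p q) \<and>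
    (\<forall>c\<in>S. \<forall>c'\<in>S. c \<noteq> c' \<longrightarrow> 4 * R m \<le> infnorm (c - c')) \<and>
    (\<forall>y\<in>cell_mid \<eta> ` Z. \<eta> ^ ?n \<le> 2 * 24 ^ ?n * (real (card (S \<inter> cube y (3 / 8 * \<eta>))) * R m ^ ?n)) \<and>
    R m \<le> \<eta> \<and> 1 \<le> m \<and> real Q / kappa / real (m ^ ?n) \<le> 1) sequentially"
    by eventually_elim (auto simp del: of_nat_power)
  then obtain m S where S: "finite S"
    and Sc: "\<And>c. c \<in> S \<Longrightarrow> \<exists>p q. kappa * real (m ^ ?n) < real q \<and> q \<le> m ^ ?n \<and> c = center (m ^ ?n) p q"
    and Ssep: "\<And>c c'. c \<in> S \<Longrightarrow> c' \<in> S \<Longrightarrow> c \<noteq> c' \<Longrightarrow> 4 * R m \<le> infnorm (c - c')"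
    and Sd: "\<And>y. y \<in> cell_mid \<eta> ` Z \<Longrightarrow>
       \<eta> ^ ?n \<le> 2 * 24 ^ ?n * (real (card (S \<inter> cube y (3 / 8 * \<eta>))) * R m ^ ?n)"
    and m: "R m \<le> \<eta>" "1 \<le> m" "real Q / kappa / real (m ^ ?n) \<le> 1"
    unfolding eventually_sequentially by (metis order_refl)
  define N where "N = m ^ ?n"
  have N: "1 \<le> N" using m by (simp add: N_def)
  have NQ: "real Q \<le> kappa * real N"
    using m(3) kappa_bounds N unfolding N_def[symmetric] by (simp add: divide_le_eq mult.commute)
  define r where "r = R m"
  have r: "0 < r" "r \<le> \<eta>" "rad N \<le> r" using m R_pos R_ge_rad by (auto simp: r_def N_def)
  have slab_cube: "slab N c \<subseteq> cube c r" for c using N r(3) by (rule slab_subset_cube)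
  let ?g = "cell_index \<eta>"
  define w where "w = (\<lambda>c. measure \<mu> (cell \<eta> (?g c)) / real (card {c'\<in>S. ?g c' = ?g c}))"
  have w0: "0 \<le> w c" for c by (simp add: w_def)
  have wsum: "sum w Y \<le> measure \<mu> (\<Union>c\<in>Y. cell \<eta> (?g c))" if "Y \<subseteq> S" for Y
    using sum_cell_weights(1)[OF finite_measure_axioms sets \<eta>(1) S w_def[THEN fun_cong] that] .
  have wtot: "sum w S = measure \<mu> (\<Union>c\<in>S. cell \<eta> (?g c))"
    using sum_cell_weights(2)[OF finite_measure_axioms sets \<eta>(1) S w_def[THEN fun_cong]] .
  have cellS [measurable]: "cell \<eta> z \<in> sets \<mu>" for z unfolding sets using \<eta>(1) by (rule cell_sets)
  have count: "\<eta> ^ ?n \<le> 2 * 24 ^ ?n * (real (card {c\<in>S. ?g c = z}) * r ^ ?n)" if "z \<in> Z" for z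
  proof -
    have "S \<inter> cube (cell_mid \<eta> z) (3 / 8 * \<eta>) \<subseteq> {c\<in>S. ?g c = z}"
      using cube_mid_subset_cell[OF \<eta>(1), of z] by (auto simp: cell_def)
    then have "card (S \<inter> cube (cell_mid \<eta> z) (3 / 8 * \<eta>)) \<le> card {c\<in>S. ?g c = z}"
      using S by (intro card_mono) auto
    then have "2 * 24 ^ ?n * (real (card (S \<inter> cube (cell_mid \<eta> z) (3 / 8 * \<eta>))) * r ^ ?n)
      \<le> 2 * 24 ^ ?n * (real (card {c\<in>S. ?g c = z}) * r ^ ?n)"
      using r by (intro mult_left_mono mult_right_mono) auto
    with Sd[of "cell_mid \<eta> z"] that show ?thesis unfolding r_def by (auto intro: order_trans)
  qed
  \<comment> \<open>\<open>\<mu>\<close> lives on \<open>X\<close>, so a cell of positive mass meets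
    \<open>X\<close>.\<close>
  have charged: "?g c \<in> Z" if "0 < w c" for c
  proof (rule ccontr)
    assume "?g c \<notin> Z"
    then have "cell \<eta> (?g c) \<subseteq> - X" by (auto simp: cell_def Z_def) (metis imageI)
    then have "measure \<mu> (cell \<eta> (?g c)) \<le> measure \<mu> (- X)"
      using borel_compact[OF X] by (intro finite_measure_mono) (auto simp: sets)
    then show False using that X0 by (simp add: w_def measure_le_0_iff)
  qed
  \<comment> \<open>A cell has mass at most \<open>F * \<eta> ^ n\<close>, and by
    \<open>count\<close> at least \<open>\<eta> ^ n / (2 * 24 ^ n * r ^ n)\<close> points share
    it.\<close>
  have wle: "w c \<le> D * r ^ ?n" for c
  proof (cases "0 < w c")
    case False
    then show ?thesis using w0[of c] D r by simp
  next
    case True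
    define k where "k = real (card {c'\<in>S. ?g c' = ?g c})"
    have cnt: "\<eta> ^ ?n \<le> 2 * 24 ^ ?n * (k * r ^ ?n)"
      using count[OF charged[OF True]] by (simp add: k_def)
    have k: "0 < k"
    proof (rule ccontr)
      assume "\<not> 0 < k"
      then have "k = 0" by (simp add: k_def)
      then show False using True by (simp add: w_def k_def[symmetric])
    qed
    have "measure \<mu> (cell \<eta> (?g c)) \<le> measure \<mu> (cube (cell_mid \<eta> (?g c)) (\<eta> / 2))"
      using cell_subset_cube_mid[OF \<eta>(1)] by (intro finite_measure_mono) (auto simp: sets)
    also have "\<dots> \<le> F * \<eta> ^ ?n"
      using F(2)[OF fmeasurable_cube[of "cell_mid \<eta> (?g c)" "\<eta> / 2"]] \<eta> by (simp add: measure_cube)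
    also have "\<dots> \<le> F * (2 * 24 ^ ?n * (k * r ^ ?n))" using cnt F by (intro mult_left_mono)
    also have "\<dots> = k * (D * r ^ ?n)" by (simp add: D_def)
    finally show ?thesis using k by (simp add: w_def k_def[symmetric] divide_le_eq mult.commute)
  qed
  \<comment> \<open>No mass is lost, since by \<open>count\<close> every cell meeting
    \<open>X\<close> contains a point of \<open>S\<close>.\<close>
  have wS: "sum w S = 1"
  proof (rule antisym)
    show "sum w S \<le> 1" unfolding wtot using bounded_measure tot' by (simp add: space)
    have XS: "X \<subseteq> (\<Union>c\<in>S. cell \<eta> (?g c))"
    proof
      fix x assume "x \<in> X"
      then have "?g x \<in> Z" by (simp add: Z_def)
      note cnt = count[OF this]
      have "card {c\<in>S. ?g c = ?g x} \<noteq> 0"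
      proof
        assume "card {c\<in>S. ?g c = ?g x} = 0"
        with cnt have "\<eta> ^ ?n \<le> 0" by simp
        with zero_less_power[OF \<eta>(1), of ?n] show False by linarith
      qed
      then obtain c where "c \<in> S" "?g c = ?g x" by (metis (mono_tags, lifting) Collect_empty_eq card.empty)
      then show "x \<in> (\<Union>c\<in>S. cell \<eta> (?g c))" by (intro UN_I[of c]) (auto simp: cell_def)
    qed
    have "1 = measure \<mu> X"
      using X0 tot' finite_measure_compl[of X] X by (simp add: sets space Compl_eq_Diff_UNIV borel_compact)
    also have "\<dots> \<le> sum w S" unfolding wtot using XS S by (intro finite_measure_mono) auto
    finally show "1 \<le> sum w S" .
  qed
  define v where "v = thick N / 2 * rad N ^ (?n - 1)"
  have v: "0 < v" "\<And>c. measure lborel (slab N c) = v"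
    using N thick_pos rad_pos measure_slab by (auto simp: v_def)
  have slabS [measurable]: "slab N c \<in> sets borel" for c by (simp add: slab_eq_cbox)
  have fmslab: "slab N c \<in> fmeasurable lborel" for c by (simp add: slab_eq_cbox)
  define f where "f = (\<lambda>y. \<Sum>c\<in>S. ennreal (w c / v) * indicator (slab N c) y)"
  have fm [measurable]: "f \<in> borel_measurable borel" unfolding f_def by measurable
  define \<mu>' where "\<mu>' = density lborel f"
  have sets': "sets \<mu>' = sets borel" by (simp add: \<mu>'_def)
  have em: "emeasure \<mu>' A = ennreal (\<Sum>c\<in>S. w c / v * measure lborel (slab N c \<inter> A))" if A: "A \<in> sets borel" for A
  proof -
    have "emeasure \<mu>' A = (\<integral>\<^sup>+ y. f y * indicator A y \<partial>lborel)"
      unfolding \<mu>'_def using A by (intro emeasure_density) auto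
    also have "\<dots> = (\<integral>\<^sup>+ y. (\<Sum>c\<in>S. ennreal (w c / v) * indicator (slab N c \<inter> A) y) \<partial>lborel)"
      by (intro nn_integral_cong) (auto simp: f_def sum_distrib_right indicator_inter_arith mult.assoc)
    also have "\<dots> = (\<Sum>c\<in>S. \<integral>\<^sup>+ y. ennreal (w c / v) * indicator (slab N c \<inter> A) y \<partial>lborel)"
      using A[measurable] by (intro nn_integral_sum) measurable
    also have "\<dots> = (\<Sum>c\<in>S. ennreal (w c / v) * emeasure lborel (slab N c \<inter> A))"
      using A by (intro sum.cong nn_integral_cmult_indicator) auto
    also have "\<dots> = (\<Sum>c\<in>S. ennreal (w c / v * measure lborel (slab N c \<inter> A)))"
    proof (intro sum.cong refl)
      fix c
      have "slab N c \<inter> A \<in> fmeasurable lborel"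
        using fmslab A by (intro fmeasurable_Int_fmeasurable) auto
      then have "emeasure lborel (slab N c \<inter> A) = ennreal (measure lborel (slab N c \<inter> A))"
        by (intro emeasure_eq_ennreal_measure) (auto simp: fmeasurable_def)
      then show "ennreal (w c / v) * emeasure lborel (slab N c \<inter> A) = ennreal (w c / v * measure lborel (slab N c \<inter> A))"
        using w0 v by (simp add: ennreal_mult[symmetric])
    qed
    also have "\<dots> = ennreal (\<Sum>c\<in>S. w c / v * measure lborel (slab N c \<inter> A))"
      using w0 v by (intro sum_ennreal) auto
    finally show ?thesis .
  qed
  have me: "measure \<mu>' A = (\<Sum>c\<in>S. w c / v * measure lborel (slab N c \<inter> A))" if A: "A \<in> sets borel" for A
    unfolding measure_def em[OF A] using w0 v by (intro enn2real_ennreal sum_nonneg) auto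
  define Y where "Y = (\<lambda>x d. {c\<in>S. slab N c \<inter> cube x d \<noteq> {}})"
  have Ysub: "Y x d \<subseteq> S" for x d by (auto simp: Y_def)
  have meY: "measure \<mu>' (cube x d) = (\<Sum>c\<in>Y x d. w c * (measure lborel (slab N c \<inter> cube x d) / measure lborel (slab N c)))" for x d
  proof -
    have "measure \<mu>' (cube x d) = (\<Sum>c\<in>S. w c * (measure lborel (slab N c \<inter> cube x d) / measure lborel (slab N c)))"
      by (subst me) (auto simp: v)
    also have "\<dots> = (\<Sum>c\<in>Y x d. w c * (measure lborel (slab N c \<inter> cube x d) / measure lborel (slab N c)))"
      using S by (intro sum.mono_neutral_right) (auto simp: Y_def)
    finally show ?thesis .
  qed
  have Yc: "c \<in> cube x (d + r)" if cY: "c \<in> Y x d" for c x d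
  proof -
    obtain y where y: "y \<in> cube c r" "y \<in> cube x d" using cY slab_cube[of c] unfolding Y_def by blast
    have "\<bar>c $ i - x $ i\<bar> \<le> d + r" for i
    proof -
      have "\<bar>y $ i - c $ i\<bar> \<le> r" "\<bar>y $ i - x $ i\<bar> \<le> d" using y unfolding cube_def by blast+
      then show ?thesis by linarith
    qed
    then show ?thesis by (simp add: cube_def)
  qed
  have coarse: "measure \<mu>' (cube x d) \<le> sum w (Y x d)" for x d
  proof -
    have "w c * (measure lborel (slab N c \<inter> cube x d) / measure lborel (slab N c)) \<le> w c * 1" for c
    proof (intro mult_left_mono w0)
      have "measure lborel (slab N c \<inter> cube x d) \<le> measure lborel (slab N c)"
        by (intro measure_mono_fmeasurable fmslab) auto
      then show "measure lborel (slab N c \<inter> cube x d) / measure lborel (slab N c) \<le> 1"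
        using v by (simp add: divide_le_eq)
    qed
    then show ?thesis unfolding meY by (intro sum_mono) simp
  qed
  have growth: "measure \<mu>' (cube x d) \<le> M' * d powr s" if d: "0 < d" for x d
  proof -
    consider "L * \<eta> \<le> d" | "r \<le> d" "d < L * \<eta>" | "d < r" by linarith
    then show ?thesis
    proof cases
      case 1
      have "measure \<mu>' (cube x d) \<le> measure \<mu> (\<Union>c\<in>Y x d. cell \<eta> (?g c))"
        using coarse wsum[OF Ysub] by (rule order_trans)
      also have "\<dots> \<le> measure \<mu> (cube x (d + 2 * \<eta>))"
      proof (rule finite_measure_mono)
        show "(\<Union>c\<in>Y x d. cell \<eta> (?g c)) \<subseteq> cube x (d + 2 * \<eta>)"
        proof safe
          fix c y assume c: "c \<in> Y x d" and y: "y \<in> cell \<eta> (?g c)"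
          have "y \<in> cube c \<eta>" using cell_subset_cube[OF \<eta>(1), of c "?g c"] y by (auto simp: cell_def)
          have "\<bar>y $ i - x $ i\<bar> \<le> d + 2 * \<eta>" for i
          proof -
            have "\<bar>y $ i - c $ i\<bar> \<le> \<eta>" using \<open>y \<in> cube c \<eta>\<close> by (simp add: cube_def)
            moreover have "\<bar>c $ i - x $ i\<bar> \<le> d + r" using Yc[OF c] by (simp add: cube_def)
            ultimately show ?thesis using r(2) by linarith
          qed
          then show "y \<in> cube x (d + 2 * \<eta>)" by (simp add: cube_def)
        qed
      qed (simp add: sets)
      also have "\<dots> \<le> M * (d + 2 * \<eta>) powr s" using d \<eta> by (intro M) auto
      also have "\<dots> \<le> M * (d * (1 + 2 / L)) powr s"
      proof (intro mult_left_mono M powr_mono2)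
        have "\<eta> \<le> d / L" using 1 L by (simp add: le_divide_eq mult.commute)
        then have "d + 2 * \<eta> \<le> d + 2 * (d / L)" by simp
        then show "d + 2 * \<eta> \<le> d * (1 + 2 / L)" by (simp add: distrib_left mult.commute)
      qed (use s d \<eta> in auto)
      also have "\<dots> = (M * (1 + 2 / L) powr s) * d powr s" using d L by (simp add: powr_mult)
      also have "\<dots> \<le> M' * d powr s" using L by (intro mult_right_mono) auto
      finally show ?thesis .
    next
      case 2
      \<comment> \<open>Intermediate radii: by separation at most about
        \<open>(4 * d / r) ^ n\<close> slabs meet the cube, each of weight at most
        \<open>D * r ^ n\<close>, giving mass of order \<open>d ^ n\<close>.\<close>
      have "real (card (Y x d)) * r ^ ?n \<le> (2 * (2 * d)) ^ ?n"
      proof (rule card_separated_in_cube)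
        show "finite (Y x d)" using S Ysub finite_subset by blast
        show "4 * r \<le> infnorm (c - c')" if "c \<in> Y x d" "c' \<in> Y x d" "c \<noteq> c'" for c c'
          using that Ssep Ysub unfolding r_def by blast
        show "Y x d \<subseteq> cube x (2 * d)"
        proof
          fix c assume "c \<in> Y x d"
          from Yc[OF this] have *: "\<bar>c $ i - x $ i\<bar> \<le> d + r" for i by (simp add: cube_def)
          have "\<bar>c $ i - x $ i\<bar> \<le> 2 * d" for i using *[of i] 2 by linarith
          then show "c \<in> cube x (2 * d)" by (simp add: cube_def)
        qed
      qed (use r 2 in auto)
      then have "real (card (Y x d)) * r ^ ?n \<le> (4 * d) ^ ?n" by simp
      then have card: "real (card (Y x d)) * r ^ ?n \<le> 4 ^ ?n * d ^ ?n"
        unfolding power_mult_distrib .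
      have "measure \<mu>' (cube x d) \<le> (\<Sum>c\<in>Y x d. D * r ^ ?n)"
        using coarse by (rule order_trans) (intro sum_mono wle)
      also have "\<dots> = D * (real (card (Y x d)) * r ^ ?n)" by simp
      also have "\<dots> \<le> D * (4 ^ ?n * d ^ ?n)" using card D by (intro mult_left_mono)
      also have "\<dots> = (D * 4 ^ ?n * d powr (real ?n - s)) * d powr s"
        using d by (simp add: powr_diff powr_realpow)
      also have "\<dots> \<le> M' * d powr s"
        using d 2 \<eta> by (intro mult_right_mono u1) auto
      finally show ?thesis .
    next
      case 3
      \<comment> \<open>For \<open>d < r\<close> at most one slab meets the cube: two such centers
        would be less than \<open>4 * r\<close> apart.\<close>
      have one: "c = c'" if "c \<in> Y x d" "c' \<in> Y x d" for c c'
      proof (rule ccontr)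
        assume ne: "c \<noteq> c'"
        have "\<bar>(c - c') $ i\<bar> < 4 * r" for i
        proof -
          have "\<bar>c $ i - x $ i\<bar> \<le> d + r" "\<bar>c' $ i - x $ i\<bar> \<le> d + r"
            using Yc[OF that(1)] Yc[OF that(2)] by (simp_all add: cube_def)
          then show ?thesis using 3 by (simp; linarith)
        qed
        then have "infnorm (c - c') < 4 * r" by (simp add: infnorm_less_iff_cart)
        moreover have "4 * r \<le> infnorm (c - c')" using Ssep[of c c'] that ne Ysub unfolding r_def by blast
        ultimately show False by simp
      qed
      show ?thesis
      proof (cases "Y x d = {}")
        case True
        then show ?thesis unfolding meY using M' by simp
      next
        case False
        then obtain c where c: "Y x d = {c}" using one by blast
        define q where "q = measure lborel (slab N c \<inter> cube x d) / measure lborel (slab N c)"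
        have q: "0 \<le> q" by (simp add: q_def)
        have "measure \<mu>' (cube x d) = w c * q" unfolding meY c q_def by simp
        also have "\<dots> \<le> D * r ^ ?n * q" using wle q by (intro mult_right_mono) auto
        also have "\<dots> = D * K ^ ?n * (1 / real N ^ (?n + 1) * q)"
          unfolding r_def R_power[OF m(2)] N_def by simp
        also have "\<dots> \<le> D * K ^ ?n * (4 * d) powr hdim"
          unfolding q_def using D K_ge by (intro mult_left_mono slab_ratio_le[OF N d]) auto
        also have "\<dots> = (D * K ^ ?n * 4 powr hdim * d powr (hdim - s)) * d powr s"
          using d by (simp add: powr_mult powr_diff)
        also have "\<dots> \<le> M' * d powr s"
        proof (intro mult_right_mono u2)
          have "1 * \<eta> \<le> L * \<eta>" using L \<eta> by (intro mult_right_mono) auto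
          then show "d \<le> u2" using 3 r \<eta> by linarith
        qed (use d in auto)
        finally show ?thesis .
      qed
    qed
  qed
  \<comment> \<open>Slabs of weight 0 are dropped because their cells may be far from
    \<open>X\<close>, and the slabs outside \<open>U\<close>.\<close>
  define X' where "X' = (\<Union>c\<in>{c\<in>S. 0 < w c}. slab N c)"
  have fr': "frostman s C \<mu>' X'"
    unfolding frostman_def
  proof (intro conjI)
    show "sets \<mu>' = sets borel" by (rule sets')
    have "emeasure \<mu>' UNIV = ennreal (sum w S)" by (subst em) (use v in auto)
    then show "emeasure \<mu>' UNIV = 1" by (simp add: wS)
    show X'c: "compact X'" unfolding X'_def using S by (intro compact_UN) (auto simp: slab_eq_cbox)
    have "measure \<mu>' (- X') = (\<Sum>c\<in>S. w c / v * measure lborel (slab N c \<inter> - X'))"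
      using borel_compact[OF X'c] by (intro me) auto
    also have "\<dots> = 0"
    proof (intro sum.neutral ballI)
      fix c assume c: "c \<in> S"
      show "w c / v * measure lborel (slab N c \<inter> - X') = 0"
      proof (cases "0 < w c")
        case True
        then have "slab N c \<inter> - X' = {}" using c by (auto simp: X'_def)
        then show ?thesis by simp
      next
        case False
        then have "w c = 0" using w0[of c] by simp
        then show ?thesis by simp
      qed
    qed
    finally show "measure \<mu>' (- X') = 0" .
    show "\<exists>F\<ge>0. \<forall>A\<in>fmeasurable lborel. measure \<mu>' A \<le> F * measure lborel A"
    proof (intro exI[of _ "\<Sum>c\<in>S. w c / v"] conjI ballI)
      show "0 \<le> (\<Sum>c\<in>S. w c / v)" using w0 v by (intro sum_nonneg) auto
      fix A assume A: "A \<in> fmeasurable (lborel :: (real^'n) measure)"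
      then have "A \<in> sets borel" by (auto dest: fmeasurableD)
      moreover have "measure lborel (slab N c \<inter> A) \<le> measure lborel A" for c
        using A slabS[of c] fmeasurableD[OF A] by (intro measure_mono_fmeasurable) auto
      ultimately show "measure \<mu>' A \<le> (\<Sum>c\<in>S. w c / v) * measure lborel A"
        unfolding sum_distrib_right using w0 v
        by (subst me) (auto intro!: sum_mono mult_left_mono simp del: times_divide_eq_left)
    qed
    show "\<exists>M<C. \<forall>x. \<forall>d>0. measure \<mu>' (cube x d) \<le> M * d powr s"
      using growth M' by blast
  qed
  have "slab N c \<subseteq> U \<inter> V Q" if c: "c \<in> S" "0 < w c" for c
  proof
    fix y assume y: "y \<in> slab N c"
    obtain x where x: "x \<in> X" "?g c = ?g x" using charged[OF c(2)] by (auto simp: Z_def)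
    have cx: "c \<in> cube x \<eta>"
      using cell_subset_cube[OF \<eta>(1), of x "?g x"] x by (auto simp: cell_def)
    have yc: "y \<in> cube c r" using y slab_cube by blast
    have "\<bar>y $ i - x $ i\<bar> \<le> \<rho>" for i
    proof -
      have "\<bar>c $ i - x $ i\<bar> \<le> \<eta>" "\<bar>y $ i - c $ i\<bar> \<le> r" using cx yc unfolding cube_def by blast+
      then show ?thesis using r \<eta> by linarith
    qed
    then have "y \<in> U" using \<rho>(2)[OF x(1)] by (auto simp: cube_def)
    moreover obtain p q where pq: "kappa * real N < real q" "q \<le> N" "c = center N p q"
      using Sc[OF c(1)] unfolding N_def by blast
    have q: "1 \<le> q" "Q \<le> q"
    proof -
      have "0 \<le> kappa * real N" using kappa_bounds by simp
      then show "1 \<le> q" using pq(1) by linarith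
      show "Q \<le> q" using pq(1) NQ by linarith
    qed
    have "y \<in> V Q"
      using slab_subset_annulus[OF q(1) pq(2), of p] y pq(3) q unfolding V_def
      by (intro UN_I[of q] UN_I[of p]) auto
    ultimately show "y \<in> U \<inter> V Q" by blast
  qed
  then have "X' \<subseteq> U \<inter> V Q" unfolding X'_def by blast
  with fr' show ?thesis by blast
qed

end

section \<open>The lower bound\<close>

text \<open>Allows covering sets, also those of diameter 0, to be enlarged to open ones at
  arbitrarily small cost.\<close>

lemma ex_slightly_larger_powr:
  fixes x s e :: real
  assumes "0 \<le> x" "0 < s" "0 < e"
  obtains d where "x < d" "d powr s \<le> x powr s + e"
proof
  let ?d = "(x powr s + e) powr (1 / s)"
  have "x = (x powr s) powr (1 / s)" using assms by (simp add: powr_powr)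
  also have "\<dots> < ?d" using assms by (intro powr_less_mono2) auto
  finally show "x < ?d" .
  have "0 \<le> x powr s" by simp
  then have "0 < x powr s + e" using assms by linarith
  then show "?d powr s \<le> x powr s + e" using assms by (simp add: powr_powr)
qed

text \<open>
  A variant of the mass distribution principle which needs no limit measure: by compactness a countable
  open cover of the intersection already covers some \<open>N j\<close>, which carries a measure of its own.
\<close>

lemma hausdorff_measure_nonzero:
  fixes A :: "(real ^ 'n) set" and N :: "nat \<Rightarrow> (real ^ 'n) set"
  assumes s: "0 < s" and C: "0 < C"
    and N: "\<And>j. compact (N j)" "\<And>i j. i \<le> j \<Longrightarrow> N j \<subseteq> N i" "(\<Inter>j. N j) \<subseteq> A"
    and mass: "\<And>j. \<exists>\<mu> X. frostman s C \<mu> X \<and> X \<subseteq> N j"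
  shows "hausdorff_measure s A \<noteq> 0"
proof
  assume H: "hausdorff_measure s A = 0"
  \<comment> \<open>The cover costs at most \<open>e\<close> and its enlargement another
    \<open>e\<close>; \<open>C * (e + e) = 1/2\<close> then contradicts total mass 1.\<close>
  define e where "e = 1 / (4 * C)"
  have e: "0 < e" using C by (simp add: e_def)
  have "hausdorff_premeasure 1 s A \<le> hausdorff_measure s A"
    unfolding hausdorff_measure_def by (intro SUP_upper) auto
  then have "hausdorff_premeasure 1 s A < ennreal e" using H e by simp
  then obtain U where U: "U \<in> hausdorff_covers 1 A" and Ue: "(\<Sum>i. hausdorff_gauge s (U i)) < ennreal e"
    unfolding hausdorff_premeasure_def by (auto simp: INF_less_iff)
  have bU: "bounded (U i)" for i using U by (simp add: hausdorff_covers_def)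
  have cU: "A \<subseteq> (\<Union>i. U i)" using U by (simp add: hausdorff_covers_def)
  have diam0: "0 \<le> diameter (U i)" for i using bU by (rule diameter_ge_0)
  have gauge: "hausdorff_gauge s (U i) = ennreal (diameter (U i) powr s)" for i
    using s by (simp add: hausdorff_gauge_def)
  have "\<exists>d. diameter (U i) < d \<and> d powr s \<le> diameter (U i) powr s + e * (1/2) ^ Suc i" for i
    using ex_slightly_larger_powr[OF diam0[of i] s, of "e * (1/2) ^ Suc i"] e by (metis mult_pos_pos zero_less_power half_gt_zero zero_less_one)
  then obtain d where d: "\<And>i. diameter (U i) < d i"
    and ds: "\<And>i. d i powr s \<le> diameter (U i) powr s + e * (1/2) ^ Suc i" by metis
  have dpos: "0 < d i" for i using d[of i] diam0[of i] by linarith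
  define x where "x = (\<lambda>i. SOME y. y \<in> U i)"
  define B where "B = (\<lambda>i. {y. infnorm (y - x i) < d i})"
  have openB: "open (B i)" for i
    unfolding B_def by (intro open_Collect_less continuous_intros)
  have UB: "U i \<subseteq> B i" for i
  proof
    fix y assume y: "y \<in> U i"
    then have "x i \<in> U i" unfolding x_def by (rule someI)
    then have "dist y (x i) \<le> diameter (U i)" using bU y by (intro diameter_bounded_bound)
    then show "y \<in> B i" using infnorm_le_norm[of "y - x i"] d[of i] by (simp add: B_def dist_norm)
  qed
  have Bcube: "B i \<subseteq> cube (x i) (d i)" for i
    by (auto simp: B_def cube_def infnorm_less_iff_cart less_imp_le)
  \<comment> \<open>Otherwise the nested nonempty compact sets \<open>N j - (\<Union>i. B i)\<close>
    would share a point, which lies in \<open>A\<close> but in no covering set.\<close>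
  have "\<exists>j. N j \<subseteq> (\<Union>i. B i)"
  proof (rule ccontr)
    assume "\<not> ?thesis"
    then have ne: "N j - (\<Union>i. B i) \<noteq> {}" for j by blast
    have "\<Inter> (range (\<lambda>j. N j - (\<Union>i. B i))) \<noteq> {}"
    proof (rule compact_nest)
      show "compact (N j - (\<Union>i. B i))" for j using N(1) openB by (intro compact_diff) auto
      show "N j - (\<Union>i. B i) \<subseteq> N i - (\<Union>i. B i)" if "i \<le> j" for i j using N(2)[OF that] by blast
    qed (rule ne)
    then obtain z where "z \<in> \<Inter> (range (\<lambda>j. N j - (\<Union>i. B i)))" by blast
    then have z: "z \<in> N j" "z \<notin> (\<Union>i. B i)" for j by auto
    then have "z \<in> A" using N(3) by (meson INT_I subsetD)
    then obtain i where "z \<in> U i" using cU by fast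
    then show False using UB[of i] z(2) by fast
  qed
  then obtain j where j: "N j \<subseteq> (\<Union>i. B i)" by blast
  obtain \<mu> X where fr: "frostman s C \<mu> X" and XN: "X \<subseteq> N j" using mass by blast
  have sets: "sets \<mu> = sets borel" and tot: "emeasure \<mu> UNIV = 1" and X: "compact X" and X0: "measure \<mu> (- X) = 0"
    using fr by (auto simp: frostman_def)
  obtain M where M: "M < C" "\<And>x d. 0 < d \<Longrightarrow> measure \<mu> (cube x d) \<le> M * d powr s"
    using fr by (auto simp: frostman_def)
  have space: "space \<mu> = UNIV" using sets_eq_imp_space_eq[OF sets] by simp
  interpret finite_measure \<mu> using tot space by (intro finite_measureI) auto
  have tot': "measure \<mu> UNIV = 1" using tot by (simp add: measure_def)
  have "X \<subseteq> (\<Union>i\<in>UNIV. B i)" using XN j by auto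
  then obtain I where I: "finite I" "X \<subseteq> (\<Union>i\<in>I. B i)"
    using compactE_image[OF X, of UNIV B] openB by metis
  have "1 = measure \<mu> X"
    using X0 tot' finite_measure_compl[of X] borel_compact[OF X] by (simp add: sets space Compl_eq_Diff_UNIV)
  also have "\<dots> \<le> measure \<mu> (\<Union>i\<in>I. cube (x i) (d i))"
  proof (rule finite_measure_mono)
    have "(\<Union>i\<in>I. B i) \<subseteq> (\<Union>i\<in>I. cube (x i) (d i))" using Bcube by (intro UN_mono) auto
    then show "X \<subseteq> (\<Union>i\<in>I. cube (x i) (d i))" using I(2) by blast
    show "(\<Union>i\<in>I. cube (x i) (d i)) \<in> sets \<mu>" unfolding sets using I by auto
  qed
  also have "\<dots> \<le> (\<Sum>i\<in>I. measure \<mu> (cube (x i) (d i)))"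
    using I by (intro measure_UNION_le) (auto simp: sets)
  also have "\<dots> \<le> (\<Sum>i\<in>I. C * (diameter (U i) powr s + e * (1/2) ^ Suc i))"
  proof (rule sum_mono)
    fix i
    have "measure \<mu> (cube (x i) (d i)) \<le> M * d i powr s" using dpos by (rule M)
    also have "\<dots> \<le> C * d i powr s" using M by (intro mult_right_mono) auto
    also have "\<dots> \<le> C * (diameter (U i) powr s + e * (1/2) ^ Suc i)"
      using ds C by (intro mult_left_mono) auto
    finally show "measure \<mu> (cube (x i) (d i)) \<le> C * (diameter (U i) powr s + e * (1/2) ^ Suc i)" .
  qed
  also have "\<dots> = C * ((\<Sum>i\<in>I. diameter (U i) powr s) + e * (\<Sum>i\<in>I. (1/2) ^ Suc i))"
    by (simp only: sum_distrib_left[symmetric] sum.distrib)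
  also have "\<dots> \<le> C * (e + e * 1)"
  proof (intro mult_left_mono add_mono)
    have "ennreal (\<Sum>i\<in>I. diameter (U i) powr s) = (\<Sum>i\<in>I. hausdorff_gauge s (U i))"
      unfolding gauge by (intro sum_ennreal[symmetric]) auto
    also have "\<dots> \<le> (\<Sum>i. hausdorff_gauge s (U i))" using I by (intro sum_le_suminf) auto
    also have "\<dots> \<le> ennreal e" using Ue by simp
    finally show "(\<Sum>i\<in>I. diameter (U i) powr s) \<le> e" using e by (simp add: ennreal_le_iff)
    have "(\<Sum>i\<in>I. (1/2::real) ^ Suc i) \<le> (\<Sum>i. (1/2) ^ Suc i)"
      using I power_half_series by (intro sum_le_suminf) (auto simp: sums_iff)
    then show "(\<Sum>i\<in>I. (1/2::real) ^ Suc i) \<le> 1" using power_half_series by (simp add: sums_iff)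
  qed (use C e in auto)
  also have "\<dots> = 1 / 2" using C by (simp add: e_def)
  finally show False by simp
qed

text \<open>Normalized Lebesgue measure on a cube of side \<open>1/2\<close> in the interior of the
  unit cube. It gives \<open>cube x d\<close> at most \<open>min 1 (4 * d) ^ n\<close>, hence the
  constant \<open>4 powr s\<close>; the \<open>+ 1\<close> makes the inequality \<open>M < C\<close>
  strict.\<close>

lemma frostman_initial:
  fixes s :: real
  assumes s: "0 \<le> s" "s \<le> real CARD('n)"
  shows "\<exists>\<mu>. frostman s (4 powr s + 1) \<mu> (cube (\<chi> i. 1/2) (1/4) :: (real ^ 'n) set)"
proof -
  let ?n = "CARD('n)"
  define X :: "(real^'n) set" where "X = cube (\<chi> i. 1/2) (1/4)"
  have mX: "measure lborel X = (1/2) ^ ?n" by (simp add: X_def measure_cube)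
  have Xs [measurable]: "X \<in> sets borel" by (simp add: X_def)
  have emX: "emeasure lborel X = ennreal ((1/2) ^ ?n)"
    using emeasure_lborel_cube_finite[of "\<chi> i. 1/2" "1/4"] mX
    by (subst emeasure_eq_ennreal_measure) (auto simp: X_def)
  have emX': "emeasure lborel X \<noteq> 0" "emeasure lborel X \<noteq> \<infinity>" unfolding emX by auto
  define \<mu> where "\<mu> = uniform_measure lborel X"
  have me: "measure \<mu> A = 2 ^ ?n * measure lborel (X \<inter> A)" if "A \<in> sets borel" for A
    unfolding \<mu>_def using that emX' by (simp add: mX power_divide)
  have le: "measure lborel (X \<inter> A) \<le> measure lborel A" if "A \<in> fmeasurable lborel" for A
    using that fmeasurableD[OF that] by (intro measure_mono_fmeasurable) auto
  have leX: "measure lborel (X \<inter> A) \<le> (1/2) ^ ?n" if "A \<in> sets borel" for A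
    unfolding mX[symmetric] using that
    by (intro measure_mono_fmeasurable) (auto simp: X_def fmeasurable_cube)
  have "frostman s (4 powr s + 1) \<mu> X"
    unfolding frostman_def
  proof (intro conjI)
    show "sets \<mu> = sets borel" by (simp add: \<mu>_def)
    show "emeasure \<mu> UNIV = 1"
      using emX' emeasure_uniform_measure[of X lborel UNIV] by (simp add: \<mu>_def emX divide_ennreal)
    show "compact X" by (simp add: X_def cube_eq_cbox)
    show "measure \<mu> (- X) = 0" by (subst me) auto
    show "\<exists>F\<ge>0. \<forall>A\<in>fmeasurable lborel. measure \<mu> A \<le> F * measure lborel A"
    proof (intro exI[of _ "2 ^ ?n"] conjI ballI)
      fix A assume A: "A \<in> fmeasurable (lborel :: (real^'n) measure)"
      then have "A \<in> sets borel" using fmeasurableD by fastforce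
      then show "measure \<mu> A \<le> 2 ^ ?n * measure lborel A"
        using le[OF A] by (subst me) auto
    qed simp
    show "\<exists>M<4 powr s + 1. \<forall>x. \<forall>d>0. measure \<mu> (cube x d) \<le> M * d powr s"
    proof (intro exI[of _ "4 powr s"] conjI allI impI)
      fix x :: "real^'n" and d :: real assume d: "0 < d"
      have "measure \<mu> (cube x d) \<le> min 1 (4 * d) ^ ?n"
      proof (cases "4 * d \<le> 1")
        case True
        have "measure \<mu> (cube x d) \<le> 2 ^ ?n * (2 * d) ^ ?n"
          using le[OF fmeasurable_cube[of x d]] d by (subst me) (auto simp: measure_cube)
        also have "\<dots> = (4 * d) ^ ?n" unfolding power_mult_distrib[symmetric] by simp
        finally show ?thesis using True by simp
      next
        case False
        have "measure \<mu> (cube x d) \<le> 2 ^ ?n * (1/2) ^ ?n"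
          using leX[of "cube x d"] by (subst me) auto
        also have "\<dots> = 1" unfolding power_mult_distrib[symmetric] by simp
        finally show ?thesis using False by simp
      qed
      also have "\<dots> \<le> (4 * d) powr s" using d s by (intro min_one_power_le_powr) auto
      also have "\<dots> = 4 powr s * d powr s" using d by (simp add: powr_mult)
      finally show "measure \<mu> (cube x d) \<le> 4 powr s * d powr s" .
    qed simp
  qed
  then show ?thesis unfolding X_def by blast
qed

section \<open>Nested neighbourhoods and the limit set\<close>

lemma compact_open_between:
  fixes X U :: "'a::euclidean_space set"
  assumes X: "compact X" and U: "open U" "X \<subseteq> U"
  obtains T where "open T" "X \<subseteq> T" "compact (closure T)" "closure T \<subseteq> U"
proof -
  obtain e where e: "0 < e" "(\<Union>x\<in>X. cball x e) \<subseteq> U"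
    using compact_subset_open_imp_cball_epsilon_subset[OF X U] by blast
  have c: "compact (\<Union>x\<in>X. cball x e)" using X by (rule compact_minkowski_sum_cball)
  have "(\<Union>x\<in>X. ball x e) \<subseteq> (\<Union>x\<in>X. cball x e)" by auto
  then have cl: "closure (\<Union>x\<in>X. ball x e) \<subseteq> (\<Union>x\<in>X. cball x e)"
    using compact_imp_closed[OF c] by (rule closure_minimal)
  show ?thesis
  proof (rule that[of "\<Union>x\<in>X. ball x e"])
    show "X \<subseteq> (\<Union>x\<in>X. ball x e)" using e by auto
    show "compact (closure (\<Union>x\<in>X. ball x e))"
      using bounded_subset[OF compact_imp_bounded[OF c] \<open>(\<Union>x\<in>X. ball x e) \<subseteq> (\<Union>x\<in>X. cball x e)\<close>]
      by simp
  qed (use e cl in auto)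
qed

context annuli
begin

text \<open>Membership in every \<open>V Q\<close> yields pairs with arbitrarily large denominators,
  hence infinitely many pairs.\<close>

lemma Inter_V_subset_W:
  fixes \<psi> \<phi> :: "nat \<Rightarrow> real"
  assumes \<psi>: "\<And>q. 1 \<le> q \<Longrightarrow> \<psi> q = real q powr (- a)"
    and \<phi>: "\<And>q. 1 \<le> q \<Longrightarrow> \<phi> q = real q powr (- b)"
    and x: "\<And>i. 0 \<le> x $ i \<and> x $ i \<le> 1" and xV: "\<And>Q. x \<in> V Q"
  shows "x \<in> W \<psi> \<phi>"
proof -
  define S where "S = {(p :: int ^ 'n, q :: nat). 1 \<le> q \<and>
            (1 - \<phi> q) * (\<psi> q / real q) < infnorm (x - rational_point p q) \<and>
            infnorm (x - rational_point p q) < \<psi> q / real q}"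
  have far: "\<exists>p q. Q \<le> q \<and> (p, q) \<in> S" for Q
  proof -
    obtain q p where q: "1 \<le> q" "Q \<le> q"
      and ann: "x \<in> annulus (rational_point p q) ((1 - real q powr (- b)) * rad q) (rad q)"
      using xV[of Q] by (auto simp: V_def)
    have rad: "\<psi> q / real q = rad q"
      using q \<psi> by (simp add: rad_def powr_diff powr_minus_divide)
    have "(p, q) \<in> S"
      using q(1) ann unfolding S_def annulus_def mem_Collect_eq prod.case rad \<phi>[OF q(1)] by blast
    then show ?thesis using q by blast
  qed
  have "infinite S"
  proof
    assume "finite S"
    then have "finite (snd ` S)" by simp
    then obtain B where B: "\<And>q. q \<in> snd ` S \<Longrightarrow> q \<le> B"
      unfolding finite_nat_set_iff_bounded_le by blast
    obtain p q where "Suc B \<le> q" "(p, q) \<in> S" using far by blast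
    with B[of q] show False by force
  qed
  then show ?thesis using x unfolding W_def S_def rational_point_def by blast
qed

lemma hausdorff_measure_W_nonzero:
  fixes \<psi> \<phi> :: "nat \<Rightarrow> real"
  assumes \<psi>: "\<And>q. 1 \<le> q \<Longrightarrow> \<psi> q = real q powr (- a)"
    and \<phi>: "\<And>q. 1 \<le> q \<Longrightarrow> \<phi> q = real q powr (- b)"
    and s: "0 < s" "s < hdim"
  shows "hausdorff_measure s (W \<psi> \<phi> :: (real ^ 'n) set) \<noteq> 0"
proof -
  define C where "C = 4 powr s + (1::real)"
  have C: "0 < C" by (simp add: C_def add_pos_pos)
  \<comment> \<open>A stage consists of a support \<open>X\<close> and an open neighbourhood
    \<open>T\<close>. The next support is found inside \<open>T \<inter> V j\<close>, and the
    closure of its neighbourhood stays there, so these closures are truly nested.\<close>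
  define P where "P = (\<lambda>(j::nat) (X, T). (\<exists>\<mu>. frostman s C \<mu> X) \<and> open T \<and> X \<subseteq> (T :: (real^'n) set))"
  define G where "G = (\<lambda>(j::nat) (X :: (real^'n) set, T) (X' :: (real^'n) set, T').
      compact (closure T') \<and> closure T' \<subseteq> T \<inter> V j)"
  define T0 :: "(real^'n) set" where "T0 = {x. \<forall>i. 0 < x $ i \<and> x $ i < 1}"
  have T0: "open T0"
  proof -
    have "T0 = Topology_Euclidean_Space.box (\<chi> i. 0) (\<chi> i. 1)" by (auto simp: T0_def mem_box_cart)
    then show ?thesis by (simp add: open_box)
  qed
  have "\<exists>f. f 0 = (cube (\<chi> i. 1/2) (1/4), T0) \<and> (\<forall>j. P j (f j)) \<and> (\<forall>j. G j (f j) (f (Suc j)))"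
  proof -
    have "s \<le> real CARD('n)" using s hdim_le_card by linarith
    moreover have "cube (\<chi> i. 1/2) (1/4) \<subseteq> T0"
    proof
      fix x :: "real^'n" assume "x \<in> cube (\<chi> i. 1/2) (1/4)"
      then have *: "\<bar>x $ i - 1/2\<bar> \<le> 1/4" for i by (simp add: cube_def)
      have "0 < x $ i \<and> x $ i < 1" for i using *[of i] by linarith
      then show "x \<in> T0" by (simp add: T0_def)
    qed
    ultimately have start: "P 0 (cube (\<chi> i. 1/2) (1/4), T0)"
      using frostman_initial[of s, where 'n='n] s T0 unfolding P_def C_def by auto
    have step: "\<exists>t'. P (Suc j) t' \<and> G j t t'" if t: "P j t" for j t
    proof -
      obtain X T \<mu> where XT: "t = (X, T)" "frostman s C \<mu> X" "open T" "X \<subseteq> T"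
        using t by (auto simp: P_def)
      obtain \<mu>' X' where X': "frostman s C \<mu>' X'" "X' \<subseteq> T \<inter> V j"
        using frostman_refine[OF less_imp_le[OF s(1)] s(2) C XT(2-4), of j] by blast
      have "compact X'" using X' by (auto simp: frostman_def)
      moreover have "open (T \<inter> V j)" using XT(3) open_V by (rule open_Int)
      ultimately obtain T' where "open T'" "X' \<subseteq> T'" "compact (closure T')" "closure T' \<subseteq> T \<inter> V j"
        using compact_open_between[of X' "T \<inter> V j"] X'(2) by metis
      then show ?thesis using X' XT by (intro exI[of _ "(X', T')"]) (auto simp: P_def G_def)
    qed
    show ?thesis
      \<comment> \<open>The clause for \<open>j = 0\<close> pins the first stage to
        \<open>T0\<close>, which confines the limit set to the unit cube.\<close>
      using dependent_nat_choice[where P="\<lambda>j t. P j t \<and> (j = 0 \<longrightarrow> t = (cube (\<chi> i. 1/2) (1/4), T0))" and Q=G]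
        start step by (metis nat.distinct(1))
  qed
  then obtain f where f0: "f 0 = (cube (\<chi> i. 1/2) (1/4), T0)" and fP: "\<And>j. P j (f j)"
    and fG: "\<And>j. G j (f j) (f (Suc j))" by blast
  define X where "X = (\<lambda>j. fst (f j))"
  define T where "T = (\<lambda>j. snd (f j))"
  have XT: "\<exists>\<mu>. frostman s C \<mu> (X j)" "X j \<subseteq> T j" for j
    using fP[of j] by (auto simp: P_def X_def T_def split_beta)
  have cl: "compact (closure (T (Suc j)))" "closure (T (Suc j)) \<subseteq> T j \<inter> V j" for j
    using fG[of j] by (auto simp: G_def T_def split_beta)
  define N where "N = (\<lambda>j. closure (T (Suc j)))"
  show ?thesis
  proof (rule hausdorff_measure_nonzero[OF s(1) C])
    show "compact (N j)" for j unfolding N_def by (rule cl)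
    have "N (Suc j) \<subseteq> N j" for j
      using cl(2)[of "Suc j"] closure_subset[of "T (Suc j)"] unfolding N_def by blast
    then show "N j \<subseteq> N i" if "i \<le> j" for i j using that by (rule lift_Suc_antimono_le)
    show "\<exists>\<mu> X. frostman s C \<mu> X \<and> X \<subseteq> N j" for j
      using XT[of "Suc j"] closure_subset[of "T (Suc j)"] unfolding N_def by blast
    show "(\<Inter>j. N j) \<subseteq> W \<psi> \<phi>"
    proof
      fix x assume x: "x \<in> (\<Inter>j. N j)"
      show "x \<in> W \<psi> \<phi>"
      proof (rule Inter_V_subset_W[OF \<psi> \<phi>])
        show "x \<in> V Q" for Q using x cl(2)[of Q] unfolding N_def by blast
        have "x \<in> T 0" using x cl(2)[of 0] unfolding N_def by blast
        then show "0 \<le> x $ i \<and> x $ i \<le> 1" for i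
          by (auto simp: T_def f0 T0_def less_imp_le)
      qed
    qed
  qed
qed

end

text \<open>The exponent \<open>s = 0\<close>, which \<open>low\<close> leaves out, needs its own
  argument: vanishing counting measure means that \<open>A\<close> is empty, and then
  \<open>low\<close> fails at \<open>h / 2\<close>.\<close>

lemma hausdorff_dim_eqI:
  fixes A :: "'a::metric_space set"
  assumes h: "0 < h"
    and up: "\<And>s. h < s \<Longrightarrow> hausdorff_measure s A = 0"
    and low: "\<And>s. 0 < s \<Longrightarrow> s < h \<Longrightarrow> hausdorff_measure s A \<noteq> 0"
  shows "hausdorff_dim A = ereal h"
proof (rule antisym)
  show "hausdorff_dim A \<le> ereal h"
  proof (rule ereal_le_epsilon2)
    fix e :: real assume "0 < e"
    then have "ereal (h + e) \<in> {ereal s | s. 0 \<le> s \<and> hausdorff_measure s A = 0}"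
      using up[of "h + e"] h by auto
    then show "hausdorff_dim A \<le> ereal h + ereal e"
      unfolding hausdorff_dim_def by (simp add: Inf_lower)
  qed
  show "ereal h \<le> hausdorff_dim A"
    unfolding hausdorff_dim_def
  proof (rule Inf_greatest)
    fix y assume "y \<in> {ereal s | s. 0 \<le> s \<and> hausdorff_measure s A = 0}"
    then obtain s where y: "y = ereal s" and s: "0 \<le> s" "hausdorff_measure s A = 0" by blast
    have "s \<noteq> 0"
    proof
      assume "s = 0"
      have "hausdorff_premeasure 1 s A \<le> hausdorff_measure s A"
        unfolding hausdorff_measure_def by (intro SUP_upper) auto
      then have "hausdorff_premeasure 1 s A < 1" using s by simp
      then obtain U where U: "U \<in> hausdorff_covers 1 A" "(\<Sum>i. hausdorff_gauge s (U i)) < 1"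
        unfolding hausdorff_premeasure_def by (auto simp: INF_less_iff)
      have "U i = {}" for i
      proof (rule ccontr)
        assume "U i \<noteq> {}"
        then have "1 = (\<Sum>i\<in>{i}. hausdorff_gauge s (U i))" by (simp add: hausdorff_gauge_def \<open>s = 0\<close>)
        also have "\<dots> \<le> (\<Sum>i. hausdorff_gauge s (U i))" by (intro sum_le_suminf) auto
        finally show False using U by simp
      qed
      then have "A = {}" using U by (auto simp: hausdorff_covers_def)
      then have "hausdorff_measure (h / 2) A = 0" by (simp add: hausdorff_measure_def SUP_eq_iff)
      then show False using low[of "h / 2"] h by simp
    qed
    then show "ereal h \<le> y" using low[of s] s y by force
  qed
qed

theorem theorem1p1:
  fixes \<tau>\<psi> \<tau>\<phi> :: real
    and \<psi> \<phi> :: "nat \<Rightarrow> real"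
  assumes "0 \<le> \<tau>\<phi>"
    and "1 / real CARD('n::finite) \<le> \<tau>\<psi>"
    and "\<And>q. 1 \<le> q \<Longrightarrow> \<psi> q = real q powr (- \<tau>\<psi>)"
    and "\<And>q. 1 \<le> q \<Longrightarrow> \<phi> q = real q powr (- \<tau>\<phi>)"
  shows "hausdorff_dim (W \<psi> \<phi> :: (real ^ 'n) set) =
    ereal (min ((real CARD('n) + 1) / (1 + \<tau>\<psi>))
               ((real CARD('n) + 1 + (real CARD('n) - 1) * \<tau>\<phi>) / (1 + \<tau>\<psi> + \<tau>\<phi>)))"
proof -
  \<comment> \<open>Any coordinate may serve as the direction \<open>i0\<close> of the chosen
    face.\<close>
  interpret annuli "undefined :: 'n" \<tau>\<psi> \<tau>\<phi>
    using assms by unfold_locales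
  have "hausdorff_dim (W \<psi> \<phi> :: (real ^ 'n) set) = ereal hdim"
  proof (rule hausdorff_dim_eqI[OF hdim_pos])
    fix s assume s: "hdim < s"
    have "(real CARD('n) + 1) / (1 + \<tau>\<psi>) < s \<or>
       (real CARD('n) + 1 + (real CARD('n) - 1) * \<tau>\<phi>) / (1 + \<tau>\<psi> + \<tau>\<phi>) < s"
      using s unfolding hdim_def by linarith
    then have "real CARD('n) + 1 < s * (1 + \<tau>\<psi>) \<or>
       real CARD('n) + 1 + (real CARD('n) - 1) * \<tau>\<phi> < s * (1 + \<tau>\<psi> + \<tau>\<phi>)"
      using a_pos b by (simp add: pos_divide_less_eq)
    then show "hausdorff_measure s (W \<psi> \<phi> :: (real ^ 'n) set) = 0"
      using assms a_pos s hdim_pos by (intro hausdorff_measure_W_eq_0_of_dim_less) auto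
  next
    fix s assume "0 < s" "s < hdim"
    then show "hausdorff_measure s (W \<psi> \<phi> :: (real ^ 'n) set) \<noteq> 0"
      using assms by (intro hausdorff_measure_W_nonzero)
  qed
  then show ?thesis by (simp add: hdim_def)
qed

end
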